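(* Let $N\ge1$ be an integer, $p>1$, $p'=\frac{p}{p-1}$, $q>1$, $\alpha>0$. Assume that either $p>2$, or $p<2$ and $\alpha<\frac{p}{2-p}$. Let $p_2=\frac{2N}{N+2}$, and $q^\ast=\frac{N(p-1)+p}{N-p}$ if $p<N$, $q^\ast=\infty$ if $N\le p$. For $a\in\mathbb{R}$ let $w(\cdot,a)$ be the solution of $$(|w'|^{p-2}w')'+\frac{N-1}{r}|w'|^{p-2}w'+rw'+\alpha w+|w|^{q-1}w=0\ \text{ in }(0,\infty),\qquad w(0)=a,\quad w'(0)=0,$$ and $L(a)=\lim_{r\to\infty}r^\alpha w(r,a)$. Assume one of the following conditions: (i) $p_2<p$, $\alpha\le N/2$ and $q\ge q^\ast$; (ii) $p\le p_2$ and $1<q$; (iii) $p_2<p$, $N/2<\alpha<(N-1)p'/2$ and $q\ge q^\ast_\alpha$, where $q^\ast_\alpha>q^\ast$ is given by $$\frac{1}{q^\ast_\alpha+1}=\frac{N-1}{2\alpha}-\frac1{p'}.$$ Then for any $a>0$, $w(r,a)>0$ on $[0,\infty)$, and $L(a)>0$.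
   Context: For every $a\in\mathbb{R}$ the initial value problem has a unique solution $w(\cdot,a)\in C^1([0,\infty))$ with $|w'|^{p-2}w'\in C^1([0,\infty))$, and the limit $L(a)\in\mathbb{R}$ exists under the stated assumption on $p,\alpha$. When $q^\ast=\infty$ the condition $q\ge q^\ast$ is never satisfied. *)

theory Defs
  imports "HOL-Analysis.Analysis"
begin

text \<open>
  The function \<open>v \<mapsto> |v|\<^sup>m\<^sup>-\<^sup>1 v\<close>, extended by 0 at \<open>v = 0\<close>. For the exponents used here
  (\<open>m = p - 1 > 0\<close> and \<open>m = q > 1\<close>) this is the continuous extension, also when \<open>m < 1\<close>.
\<close>
definition signed_pow :: "real \<Rightarrow> real \<Rightarrow> real" where
  "signed_pow m v = \<bar>v\<bar> powr (m - 1) * v"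

text \<open>
  \<open>dw\<close> is \<open>w'\<close> and \<open>df\<close> is \<open>(|w'|\<^sup>p\<^sup>-\<^sup>2 w')'\<close>, with one-sided derivatives at the endpoint 0. Only the
  values of \<open>w\<close> on \<open>[0,\<infinity>)\<close> matter.
\<close>
definition is_solution ::
  "nat \<Rightarrow> real \<Rightarrow> real \<Rightarrow> real \<Rightarrow> real \<Rightarrow> (real \<Rightarrow> real) \<Rightarrow> bool" where
  "is_solution N p q \<alpha> a w \<longleftrightarrow>
     (\<exists>dw df.
        (\<forall>r\<ge>0. (w has_real_derivative dw r) (at r within {0..})) \<and>
        continuous_on {0..} dw \<and>
        (\<forall>r\<ge>0. ((\<lambda>s. signed_pow (p - 1) (dw s)) has_real_derivative df r) (at r within {0..})) \<and>
        continuous_on {0..} df \<and>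
        (\<forall>r>0. df r + (real N - 1) / r * signed_pow (p - 1) (dw r)
                + r * dw r + \<alpha> * w r + signed_pow q (w r) = 0) \<and>
        w 0 = a \<and> dw 0 = 0)"

definition conj_exp :: "real \<Rightarrow> real" where
  "conj_exp p = p / (p - 1)"

definition p2 :: "nat \<Rightarrow> real" where
  "p2 N = 2 * real N / (real N + 2)"

definition q_star :: "nat \<Rightarrow> real \<Rightarrow> ereal" where
  "q_star N p =
     (if p < real N then ereal ((real N * (p - 1) + p) / (real N - p)) else \<infinity>)"

text \<open>The solution of \<open>1 / (Q + 1) = (N - 1) / (2 \<alpha>) - 1 / p'\<close> for \<open>Q\<close>.\<close>
definition q_star_alpha :: "nat \<Rightarrow> real \<Rightarrow> real \<Rightarrow> real" where
  "q_star_alpha N p \<alpha> = 1 / ((real N - 1) / (2 * \<alpha>) - 1 / conj_exp p) - 1"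

lemma q_star_alpha_eq:
  "1 / (q_star_alpha N p \<alpha> + 1) = (real N - 1) / (2 * \<alpha>) - 1 / conj_exp p"
  by (simp add: q_star_alpha_def)

lemma q_star_alpha_greater:
  assumes "N \<ge> 1" "p > 1" "real N / 2 < \<alpha>" "\<alpha> < (real N - 1) * conj_exp p / 2"
  shows "q_star N p < ereal (q_star_alpha N p \<alpha>)"
proof -
  define n where "n = real N"
  have n: "n \<ge> 1" using assms by (simp add: n_def)
  have a: "\<alpha> > 0" "n / 2 < \<alpha>" using assms n by (auto simp: n_def)
  have a2: "\<alpha> < (n - 1) * conj_exp p / 2" using assms by (simp add: n_def)
  have c: "conj_exp p > 0" using assms by (simp add: conj_exp_def)
  have "n < (n - 1) * conj_exp p" using a a2 by simp
  hence pn: "p < n" using assms(2) by (simp add: conj_exp_def field_simps)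
  have e: "(n * (p - 1) + p) / (n - p) = 1 / ((n - 1) / n - 1 / conj_exp p) - 1"
  proof -
    have "(n - 1) / n - 1 / conj_exp p = (n - p) / (n * p)"
      using n assms(2) by (simp add: conj_exp_def field_simps)
    thus ?thesis using pn by (simp add: field_simps)
  qed
  have p0: "0 < (n - 1) / (2 * \<alpha>) - 1 / conj_exp p"
    using a a2 c by (simp add: field_simps)
  have "n > 1" using pn assms(2) by simp
  hence "(n - 1) / (2 * \<alpha>) < (n - 1) / n"
    using a n by (intro divide_strict_left_mono) auto
  hence "1 / ((n - 1) / n - 1 / conj_exp p) < 1 / ((n - 1) / (2 * \<alpha>) - 1 / conj_exp p)"
    using p0 by (intro divide_strict_left_mono) auto
  thus ?thesis using pn e by (simp add: q_star_def q_star_alpha_def n_def)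
qed

end

(*
  Write z = -w', psi = z^(p-1).  For suitable k, e, l the Pohozaev-type function
    V(r) = r^k ((p-1)/p z^p + w^(q+1)/(q+1) + e w^2/2 - l w psi/r)
  starts at 0 and satisfies V' <= -r^(k-1) (r z - c w)^2 as long as w > 0, so it is negative and
  bounded away from 0 at later times; at a first zero of w it would be nonnegative, hence w > 0.
  The choices are k = N with l = (N-p)/p in case (i) and l = N/2 in case (ii), and k = 2 alpha in
  case (iii).

  Put X = r w/psi, h = r z/w and Y = r^p w^(2-p) = X h^(p-1).  If h >= alpha + eta then X grows like a
  positive power of r, provided X > 1 (when alpha < N) or X is large; if h <= alpha + eta then Y does,
  since (2-p) alpha < p.  Hence min(X, Y/(alpha+eta)^(p-1)) grows and X tends to infinity.  The
  provisos come from V: for k = N, X <= 1 forever would give w, psi/r = O(r^(-N)), and for k = 2 alpha,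
  X bounded along a sequence would bound h and Y; both make V small.  Once X is large,
  ln (r^alpha (w - psi/r)) has an integrable derivative, so r^alpha w has a positive limit.
*)
theory Submission
  imports Defs "HOL-Real_Asymp.Real_Asymp"
begin

section \<open>Monotonicity and convergence facts for real functions\<close>

lemma ge_right_of_point:
  fixes f :: "real \<Rightarrow> real"
  assumes "(f has_real_derivative D) (at t)" "m \<le> f t" "f t = m \<Longrightarrow> D > 0"
  shows "\<exists>d>0. \<forall>h. 0 < h \<and> h < d \<longrightarrow> m \<le> f (t + h)"
proof (cases "f t = m")
  case True
  then obtain d where "d > 0" "\<And>h. h > 0 \<Longrightarrow> h < d \<Longrightarrow> f t < f (t + h)"
    using DERIV_pos_inc_right[OF assms(1)] assms(3) by blast
  thus ?thesis using True by (metis less_imp_le)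
next
  case False
  hence "m < f t" using assms by simp
  moreover have "(f \<longlongrightarrow> f t) (at t)" using assms(1) DERIV_isCont isCont_def by blast
  ultimately have "eventually (\<lambda>s. m < f s) (at t)" by (rule order_tendstoD(1)[rotated])
  then obtain d where "d > 0" "\<And>s. s \<noteq> t \<Longrightarrow> dist s t < d \<Longrightarrow> m < f s"
    by (auto simp: eventually_at)
  thus ?thesis by (intro exI[of _ d]) (auto simp: dist_real_def less_imp_le)
qed

text \<open>At each point only the smaller function has to increase. Let \<open>t\<close> be the
  last point of [R, x] where both functions are at least their initial minimum \<open>m\<close>. If
  t < x, a function equal to \<open>m\<close> at \<open>t\<close> is the smaller one and increases
  there, so a point beyond \<open>t\<close> would qualify too.\<close>

lemma min_mono_of_deriv_pos:
  fixes f g :: "real \<Rightarrow> real"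
  assumes f: "\<And>x. x \<ge> R \<Longrightarrow> (f has_real_derivative f' x) (at x)"
    and g: "\<And>x. x \<ge> R \<Longrightarrow> (g has_real_derivative g' x) (at x)"
    and f': "\<And>x. x \<ge> R \<Longrightarrow> f x \<le> g x \<Longrightarrow> f' x > 0"
    and g': "\<And>x. x \<ge> R \<Longrightarrow> g x \<le> f x \<Longrightarrow> g' x > 0"
    and "R \<le> x"
  shows "min (f R) (g R) \<le> min (f x) (g x)"
proof (rule ccontr)
  define m where "m = min (f R) (g R)"
  assume "\<not> ?thesis"
  hence x: "\<not> m \<le> min (f x) (g x)" by (simp add: m_def)
  define S where "S = {R..x} \<inter> (\<lambda>s. min (f s) (g s)) -` {m..}"
  have "continuous_on {R..x} f" "continuous_on {R..x} g"
    by (auto intro!: DERIV_continuous_on[OF has_field_derivative_at_within] f g)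
  hence "closed S" unfolding S_def
    by (intro continuous_closed_preimage continuous_on_min) auto
  moreover have "R \<in> S" using \<open>R \<le> x\<close> by (simp add: S_def m_def)
  moreover have bdd: "bdd_above S" by (rule bdd_aboveI[of _ x]) (auto simp: S_def)
  ultimately have tS: "Sup S \<in> S" using closed_contains_Sup[of S] by blast
  define t where "t = Sup S"
  have t: "R \<le> t" "t \<le> x" "m \<le> f t" "m \<le> g t" using tS by (auto simp: S_def t_def)
  have "t \<noteq> x" using x t by auto
  hence tx: "t < x" using t by simp
  obtain d1 where d1: "d1 > 0" "\<And>h. 0 < h \<Longrightarrow> h < d1 \<Longrightarrow> m \<le> f (t + h)"
    using ge_right_of_point[OF f[OF t(1)] t(3)] f'[OF t(1)] t(4) by auto
  obtain d2 where d2: "d2 > 0" "\<And>h. 0 < h \<Longrightarrow> h < d2 \<Longrightarrow> m \<le> g (t + h)"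
    using ge_right_of_point[OF g[OF t(1)] t(4)] g'[OF t(1)] t(3) by auto
  define h where "h = min (min d1 d2) (x - t) / 2"
  have h: "0 < h" "h < d1" "h < d2" "h \<le> x - t" using d1 d2 tx by (auto simp: h_def)
  hence "t + h \<in> S" using d1 d2 t by (auto simp: S_def)
  hence "t + h \<le> t" unfolding t_def by (rule cSup_upper[OF _ bdd])
  thus False using h by simp
qed

lemma antimono_bounded_below_tendsto:
  fixes f :: "real \<Rightarrow> real"
  assumes mono: "\<And>x y. R \<le> x \<Longrightarrow> x \<le> y \<Longrightarrow> f y \<le> f x" and bdd: "\<And>x. R \<le> x \<Longrightarrow> B \<le> f x"
  shows "\<exists>l. (f \<longlongrightarrow> l) at_top"
proof -
  define l where "l = Inf (f ` {R..})"
  have bb: "bdd_below (f ` {R..})" using bdd by (auto intro!: bdd_belowI[of _ B])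
  have "(f \<longlongrightarrow> l) at_top"
  proof (rule decreasing_tendsto)
    show "eventually (\<lambda>x. l \<le> f x) at_top"
      using eventually_ge_at_top[of R] by eventually_elim (auto simp: l_def intro!: cInf_lower bb)
  next
    fix u assume "l < u"
    then obtain x where x: "R \<le> x" "f x < u"
      using bb unfolding l_def by (subst (asm) cInf_less_iff) auto
    show "eventually (\<lambda>x. f x < u) at_top"
      using eventually_ge_at_top[of x] by eventually_elim (use x mono in force)
  qed
  thus ?thesis ..
qed

section \<open>The initial value problem and the sign of the flux\<close>

locale radial_ivp =
  fixes N :: nat and p q \<alpha> a :: real and w dw df :: "real \<Rightarrow> real"
  assumes N: "N \<ge> 1" and p: "p > 1" and q: "q > 1" and \<alpha>: "\<alpha> > 0" and a: "a > 0"
    and w_deriv0: "\<And>r. r \<ge> 0 \<Longrightarrow> (w has_real_derivative dw r) (at r within {0..})"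
    and dw_cont: "continuous_on {0..} dw"
    and flux_deriv0: "\<And>r. r \<ge> 0 \<Longrightarrow>
      ((\<lambda>s. signed_pow (p - 1) (dw s)) has_real_derivative df r) (at r within {0..})"
    and ode: "\<And>r. r > 0 \<Longrightarrow> df r + (real N - 1) / r * signed_pow (p - 1) (dw r)
                + r * dw r + \<alpha> * w r + signed_pow q (w r) = 0"
    and w_0: "w 0 = a" and dw_0: "dw 0 = 0"
begin

definition "z r = - dw r"
text \<open>The odd power gives this a meaning before the sign of \<open>z\<close> is known; where
  \<open>z r > 0\<close> it is z^(p-1).\<close>

definition "\<psi> r = - signed_pow (p - 1) (dw r)"

lemma w_deriv: "r > 0 \<Longrightarrow> (w has_real_derivative - z r) (at r)"
  using w_deriv0[of r] at_within_interior[of r "{0..}"] by (simp add: z_def)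

lemma \<psi>_deriv:
  assumes "r > 0"
  shows "(\<psi> has_real_derivative
    \<alpha> * w r + signed_pow q (w r) - r * z r - (real N - 1) / r * \<psi> r) (at r)"
proof -
  have "((\<lambda>s. signed_pow (p - 1) (dw s)) has_real_derivative df r) (at r)"
    using flux_deriv0[of r] at_within_interior[of r "{0..}"] assms by simp
  hence "((\<lambda>s. - signed_pow (p - 1) (dw s)) has_real_derivative - df r) (at r)"
    by (rule DERIV_minus)
  moreover have "- df r = \<alpha> * w r + signed_pow q (w r) - r * z r - (real N - 1) / r * \<psi> r"
    using ode[OF assms] by (simp add: z_def \<psi>_def algebra_simps)
  ultimately show ?thesis unfolding \<psi>_def[abs_def] by simp
qed

lemma w_cont: "continuous_on {0..} w"
  by (rule DERIV_continuous_on[of _ _ dw]) (use w_deriv0 in auto)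

lemma \<psi>_cont: "continuous_on {0..} \<psi>"
  unfolding \<psi>_def[abs_def]
  by (rule continuous_on_minus, rule DERIV_continuous_on[of _ _ df]) (use flux_deriv0 in auto)

lemma z_cont: "continuous_on {0..} z"
  unfolding z_def[abs_def] by (intro continuous_on_minus dw_cont)

lemma at_right_limits:
  "(w \<longlongrightarrow> a) (at_right 0)" "(z \<longlongrightarrow> 0) (at_right 0)" "(\<psi> \<longlongrightarrow> 0) (at_right 0)"
proof -
  have lim: "(f \<longlongrightarrow> f 0) (at_right 0)" if "continuous_on {0..} f" for f :: "real \<Rightarrow> real"
  proof (rule tendsto_mono)
    show "at_right 0 \<le> at (0::real) within {0..}" by (rule at_le) auto
    show "(f \<longlongrightarrow> f 0) (at 0 within {0..})"
      using that unfolding continuous_on_def by (rule bspec) simp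
  qed
  have "\<psi> 0 = 0" "z 0 = 0" using dw_0 by (simp_all add: \<psi>_def z_def signed_pow_def)
  thus "(w \<longlongrightarrow> a) (at_right 0)" "(z \<longlongrightarrow> 0) (at_right 0)" "(\<psi> \<longlongrightarrow> 0) (at_right 0)"
    using lim[OF w_cont] lim[OF z_cont] lim[OF \<psi>_cont] w_0 by simp_all
qed

text \<open>The weight r^(N-1) absorbs the singular term (N-1)/r \<open>\<psi>\<close>: the
  derivative of \<open>u\<close> is r^(N-1) times a factor that is positive near 0, because \<alpha>
  w - r z tends to \<alpha> a > 0.\<close>

lemma \<psi>_pos_near_0: "\<exists>\<rho>>0. \<forall>r. 0 < r \<and> r < \<rho> \<longrightarrow> \<psi> r > 0"
proof -
  define u where "u r = r ^ (N - 1) * \<psi> r" for r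
  have "((\<lambda>r. \<alpha> * w r - r * z r) \<longlongrightarrow> \<alpha> * a - 0 * 0) (at_right 0)"
    by (intro tendsto_intros at_right_limits)
  hence "eventually (\<lambda>r. \<alpha> * w r - r * z r > 0) (at_right 0)"
    by (rule order_tendstoD(1)) (use \<alpha> a in simp)
  moreover have "eventually (\<lambda>r. w r > 0) (at_right 0)"
    by (rule order_tendstoD(1)[OF at_right_limits(1) a])
  ultimately have "eventually (\<lambda>r. \<alpha> * w r - r * z r > 0 \<and> w r > 0) (at_right 0)"
    by eventually_elim auto
  then obtain \<rho> where \<rho>: "\<rho> > 0"
    and pos: "\<And>r. 0 < r \<Longrightarrow> r < \<rho> \<Longrightarrow> \<alpha> * w r - r * z r > 0 \<and> w r > 0"
    by (auto simp: eventually_at_right_field)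
  have "\<psi> r > 0" if r: "0 < r" "r < \<rho>" for r
  proof -
    have "u 0 < u r"
    proof (rule DERIV_pos_imp_increasing_open[OF r(1)])
      fix x assume x: "0 < x" "x < r"
      \<comment> \<open>If N = 1, the exponent on the left truncates to 0 and both sides are
        0.\<close>
      have eq: "real (N - 1) * x ^ (N - 1 - 1) = (real N - 1) / x * x ^ (N - 1)"
        using x N by (cases "N - 1") (auto simp: of_nat_diff)
      have d: "(u has_real_derivative (real (N - 1) * x ^ (N - 1 - 1)) * \<psi> x
          + (\<alpha> * w x + signed_pow q (w x) - x * z x - (real N - 1) / x * \<psi> x) * x ^ (N - 1)) (at x)"
        unfolding u_def[abs_def]
        using x by (auto intro!: derivative_eq_intros \<psi>_deriv)
      have "(u has_real_derivative
          x ^ (N - 1) * (\<alpha> * w x - x * z x + signed_pow q (w x))) (at x)"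
        using d unfolding eq by (simp add: algebra_simps)
      moreover have "signed_pow q (w x) > 0"
        using pos[of x] x r by (simp add: signed_pow_def)
      hence "x ^ (N - 1) * (\<alpha> * w x - x * z x + signed_pow q (w x)) > 0"
        using pos[of x] x r by (intro mult_pos_pos add_pos_pos) auto
      ultimately show "\<exists>y. (u has_real_derivative y) (at x) \<and> 0 < y" by blast
    next
      show "continuous_on {0..r} u"
        unfolding u_def[abs_def]
        by (intro continuous_intros continuous_on_subset[OF \<psi>_cont]) auto
    qed
    moreover have "u 0 = 0"
      using dw_0 by (simp add: u_def \<psi>_def signed_pow_def)
    ultimately have "0 < u r" by simp
    hence "0 < r ^ (N - 1) * \<psi> r" by (simp only: u_def)
    thus ?thesis using r by (simp only: zero_less_mult_iff) auto
  qed
  thus ?thesis using \<rho> by blast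
qed

text \<open>At a first zero of \<open>\<psi>\<close> also \<open>z\<close> vanishes, so the equation
  leaves the derivative \<alpha> w + w^q > 0 for \<open>\<psi>\<close>, which is impossible after
  positive values.\<close>

lemma \<psi>_pos:
  assumes "r > 0" "\<And>s. 0 < s \<Longrightarrow> s \<le> r \<Longrightarrow> w s > 0"
  shows "\<psi> r > 0"
proof (rule ccontr)
  assume neg: "\<not> \<psi> r > 0"
  obtain \<rho> where \<rho>: "\<rho> > 0" "\<And>s. 0 < s \<Longrightarrow> s < \<rho> \<Longrightarrow> \<psi> s > 0"
    using \<psi>_pos_near_0 by blast
  \<comment> \<open>The interval starts at a positive radius because \<open>\<psi> 0 = 0\<close>;
    smaller radii are covered by the choice of \<rho>.\<close>
  define S where "S = {min \<rho> r / 2..r} \<inter> \<psi> -` {..0}"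
  have lo: "min \<rho> r / 2 > 0" using \<rho> assms by simp
  have "closed S" unfolding S_def
    by (intro continuous_closed_preimage continuous_on_subset[OF \<psi>_cont]) (use lo in auto)
  moreover have "r \<in> S" using neg lo assms by (auto simp: S_def)
  moreover have bdd: "bdd_below S" by (rule bdd_belowI[of _ 0]) (use lo in \<open>auto simp: S_def\<close>)
  ultimately have tS: "Inf S \<in> S" using closed_contains_Inf[of S] by blast
  define t where "t = Inf S"
  have t: "t > 0" "t \<le> r" "\<psi> t \<le> 0" using tS lo by (auto simp: S_def t_def)
  have before: "\<psi> s > 0" if "0 < s" "s < t" for s
  proof (cases "s < min \<rho> r / 2")
    case True
    thus ?thesis using \<rho> that by auto
  next
    case False
    thus ?thesis using that t cInf_lower[OF _ bdd, of s] by (force simp: S_def t_def)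
  qed
  have ct: "isCont \<psi> t" using \<psi>_deriv[OF t(1)] DERIV_isCont by blast
  have "\<psi> t = 0"
  proof (rule ccontr)
    assume "\<psi> t \<noteq> 0"
    hence "\<psi> t < 0" using t by simp
    with ct have "eventually (\<lambda>s. \<psi> s < 0) (at_left t)"
      by (metis isCont_def filterlim_at_split order_tendstoD(2))
    moreover have "eventually (\<lambda>s. 0 < s \<and> s < t) (at_left t)"
      using t(1) eventually_at_left_real by fastforce
    ultimately have "eventually (\<lambda>s. False) (at_left t)"
      by eventually_elim (use before in force)
    thus False by simp
  qed
  hence zt: "z t = 0" by (simp add: \<psi>_def signed_pow_def z_def)
  have wt: "w t > 0" using assms t by simp
  have "(\<psi> has_real_derivative \<alpha> * w t + signed_pow q (w t)) (at t)"
    using \<psi>_deriv[OF t(1)] zt \<open>\<psi> t = 0\<close> by simp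
  moreover have "\<alpha> * w t + signed_pow q (w t) > 0"
    using wt \<alpha> by (simp add: signed_pow_def add_pos_pos)
  ultimately obtain d where d: "d > 0" "\<And>h. h > 0 \<Longrightarrow> h < d \<Longrightarrow> \<psi> (t - h) < \<psi> t"
    using DERIV_pos_inc_left by blast
  define h where "h = min d t / 2"
  have "h > 0" "h < d" "h < t" using d t by (auto simp: h_def)
  thus False using d(2)[of h] before[of "t - h"] \<open>\<psi> t = 0\<close> by auto
qed

lemma z_pos_iff: "z r > 0 \<longleftrightarrow> \<psi> r > 0"
  by (auto simp: z_def \<psi>_def signed_pow_def mult_less_0_iff)

lemma \<psi>_powr: "z r > 0 \<Longrightarrow> \<psi> r = z r powr (p - 1)"
  using powr_mult_base[of "- dw r" "p - 1 - 1"]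
  by (simp add: z_def \<psi>_def signed_pow_def mult.commute)

lemma z_powr: "\<psi> r > 0 \<Longrightarrow> z r = \<psi> r powr (1 / (p - 1))"
  using \<psi>_powr[of r] z_pos_iff[of r] p by (simp add: powr_powr)

text \<open>The equation provides a derivative of \<open>\<psi>\<close>, not of \<open>z\<close>.
  Near \<open>r\<close> the product is therefore written as the power p/(p-1) of
  \<open>\<psi>\<close> and differentiated in that form.\<close>

lemma z\<psi>_deriv:
  assumes "r > 0" "\<psi> r > 0"
  shows "((\<lambda>s. (p - 1) / p * (z s * \<psi> s)) has_real_derivative
    z r * (\<alpha> * w r + signed_pow q (w r) - r * z r - (real N - 1) / r * \<psi> r)) (at r)"
    (is "(_ has_real_derivative z r * ?D) _")
proof -
  have ex: "1 / (p - 1) + 1 = p / (p - 1)" using p by (simp add: field_simps)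
  have "isCont \<psi> r" using \<psi>_deriv[OF assms(1)] DERIV_isCont by blast
  hence ev: "eventually (\<lambda>s. \<psi> s > 0) (nhds r)"
    using assms(2) by (simp add: isCont_def order_tendstoD(1) tendsto_at_iff_tendsto_nhds)
  have ev': "eventually (\<lambda>s. (p - 1) / p * (z s * \<psi> s) = (p - 1) / p * \<psi> s powr (p / (p - 1))) (nhds r)"
    using ev
  proof eventually_elim
    case (elim s)
    have "z s * \<psi> s = \<psi> s powr (1 / (p - 1)) * \<psi> s powr 1" using elim z_powr[of s] by simp
    thus ?case by (simp only: powr_add[symmetric] ex)
  qed
  have "((\<lambda>s. \<psi> s powr (p / (p - 1))) has_real_derivative
      (p / (p - 1)) * \<psi> r powr (p / (p - 1) - 1) * ?D) (at r)"
    using DERIV_fun_powr[OF \<psi>_deriv[OF assms(1)] assms(2), of "p / (p - 1)"] by simp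
  hence "((\<lambda>s. (p - 1) / p * \<psi> s powr (p / (p - 1))) has_real_derivative
      (p - 1) / p * ((p / (p - 1)) * \<psi> r powr (p / (p - 1) - 1) * ?D)) (at r)"
    by (rule DERIV_cmult)
  moreover have "\<psi> r powr (p / (p - 1) - 1) = z r"
    using z_powr[of r] assms ex by (metis add_diff_cancel_right')
  ultimately have "((\<lambda>s. (p - 1) / p * \<psi> s powr (p / (p - 1))) has_real_derivative z r * ?D) (at r)"
    using p by simp
  thus ?thesis using DERIV_cong_ev[OF refl ev' refl] by blast
qed

end

section \<open>The Pohozaev-type function and positivity of the solution\<close>

text \<open>
  The assumptions \<open>coeff_z\<close>, \<open>coeff_q\<close> and \<open>k_ge\<close> give the terms of \<open>V'\<close> in \<open>z \<psi>\<close>, \<open>w\<^sup>q\<^sup>+\<^sup>1\<close> and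
  \<open>w \<psi> / r\<close> the right sign; \<open>coeff_mixed\<close> and \<open>coeff_square\<close> bound the quadratic form in \<open>r z\<close>
  and \<open>w\<close> by \<open>- (r z - c w)\<^sup>2\<close>.
\<close>
locale pohozaev_ivp = radial_ivp +
  fixes k e l c :: real
  assumes k: "k > 1" and l: "l > 0" and c: "c > 0"
    and coeff_z: "k * (p - 1) / p - (real N - 1) + l \<le> 0"
    and coeff_q: "k / (q + 1) \<le> l"
    and k_ge: "real N \<le> k"
    and coeff_mixed: "e - \<alpha> - l = - 2 * c"
    and coeff_square: "k * e / 2 - l * \<alpha> \<le> - c\<^sup>2"
begin

definition "V r = r powr k * ((p - 1) / p * (z r * \<psi> r) + w r powr (q + 1) / (q + 1)
    + e * (w r)\<^sup>2 / 2 - l * w r * \<psi> r / r)"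

text \<open>Once the equation is substituted, z w^q cancels against the derivative of w^(q+1)/(q+1).
  Divided by r^(k-1), the rest consists of nonpositive terms in z \<open>\<psi>\<close>, w^(q+1) and
  w \<open>\<psi>\<close>/r, and of the quadratic form -(r z)^2 + 2 c (r z) w + (k e/2 - l \<alpha>)
  w^2.\<close>

lemma V_deriv:
  assumes r: "r > 0" and w: "w r > 0" and \<psi>: "\<psi> r > 0"
  shows "\<exists>D. (V has_real_derivative D) (at r) \<and> D \<le> - (r powr (k - 1) * (r * z r - c * w r)\<^sup>2)"
proof -
  have z: "z r > 0" using \<psi> z_pos_iff by simp
  define \<psi>' where "\<psi>' = \<alpha> * w r + w r powr q - r * z r - (real N - 1) / r * \<psi> r"
  have sp: "signed_pow q (w r) = w r powr q"
    using w by (simp add: signed_pow_def powr_diff)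
  have d1: "(w has_real_derivative - z r) (at r)" by (rule w_deriv[OF r])
  have d2: "(\<psi> has_real_derivative \<psi>') (at r)" using \<psi>_deriv[OF r] by (simp add: sp \<psi>'_def)
  have d3: "((\<lambda>s. (p - 1) / p * (z s * \<psi> s)) has_real_derivative z r * \<psi>') (at r)"
    using z\<psi>_deriv[OF r \<psi>] by (simp add: sp \<psi>'_def)
  have d4: "((\<lambda>s. w s powr (q + 1)) has_real_derivative (q + 1) * w r powr (q + 1 - 1) * (- z r)) (at r)"
    using DERIV_fun_powr[OF d1 w, of "q + 1"] by simp
  have d4': "((\<lambda>s. w s powr (q + 1) / (q + 1)) has_real_derivative - (w r powr q) * z r) (at r)"
    using DERIV_cdivide[OF d4, of "q + 1"] q by simp
  have d5: "((\<lambda>s. s powr k) has_real_derivative k * r powr (k - 1)) (at r)"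
    using r by (auto intro!: derivative_eq_intros)
  have d6: "((\<lambda>s. e * (w s)\<^sup>2 / 2) has_real_derivative - e * w r * z r) (at r)"
    by (rule derivative_eq_intros d1 refl | simp)+
  have d7: "((\<lambda>s. l * w s * \<psi> s / s) has_real_derivative
      l * (- z r * \<psi> r + w r * \<psi>') / r - l * w r * \<psi> r / r\<^sup>2) (at r)"
    by (rule derivative_eq_intros d1 d2 refl | use r in \<open>simp add: field_simps power2_eq_square\<close>)+
  define D where "D = k * r powr (k - 1) * ((p - 1) / p * (z r * \<psi> r) + w r powr (q + 1) / (q + 1)
    + e * (w r)\<^sup>2 / 2 - l * w r * \<psi> r / r) + (z r * \<psi>' + (- (w r powr q) * z r) + (- e * w r * z r)
    - (l * (- z r * \<psi> r + w r * \<psi>') / r - l * w r * \<psi> r / r\<^sup>2)) * r powr k"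
  have D: "(V has_real_derivative D) (at r)"
    unfolding V_def[abs_def] D_def
    by (rule DERIV_mult[OF d5 DERIV_diff[OF DERIV_add[OF DERIV_add[OF d3 d4'] d6] d7]])
  have rk: "r powr k = r powr (k - 1) * r" using r by (simp add: powr_diff)
  have wq: "w r powr (q + 1) = w r powr q * w r" using w by (simp add: powr_add)
  have q1: "q + 1 \<noteq> 0" using q by simp
  have "D = r powr (k - 1) * ((k * (p - 1) / p - (real N - 1) + l) * (z r * \<psi> r)
      - (l - k / (q + 1)) * (w r powr q * w r) - l * (k - real N) * (w r * \<psi> r / r)
      + (- (r * z r)\<^sup>2 - (e - \<alpha> - l) * (r * z r) * w r + (k * e / 2 - l * \<alpha>) * (w r)\<^sup>2))"
    unfolding D_def rk wq \<psi>'_def using r p q1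
    by (simp add: divide_simps power2_eq_square) (simp add: algebra_simps)
  also have "\<dots> \<le> r powr (k - 1) * (- (r * z r - c * w r)\<^sup>2)"
  proof (rule mult_left_mono)
    have "(k * (p - 1) / p - (real N - 1) + l) * (z r * \<psi> r) \<le> 0"
      using coeff_z z \<psi> by (simp add: mult_nonpos_nonneg)
    moreover have "(l - k / (q + 1)) * (w r powr q * w r) \<ge> 0"
      using coeff_q w by simp
    moreover have "l * (k - real N) * (w r * \<psi> r / r) \<ge> 0"
      using k_ge l w \<psi> r by simp
    moreover have "(k * e / 2 - l * \<alpha>) * (w r)\<^sup>2 \<le> - c\<^sup>2 * (w r)\<^sup>2"
      by (rule mult_right_mono[OF coeff_square]) simp
    ultimately show "(k * (p - 1) / p - (real N - 1) + l) * (z r * \<psi> r)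
      - (l - k / (q + 1)) * (w r powr q * w r) - l * (k - real N) * (w r * \<psi> r / r)
      + (- (r * z r)\<^sup>2 - (e - \<alpha> - l) * (r * z r) * w r + (k * e / 2 - l * \<alpha>) * (w r)\<^sup>2)
      \<le> - (r * z r - c * w r)\<^sup>2"
      unfolding coeff_mixed by (simp add: power2_eq_square algebra_simps)
  qed simp
  finally show ?thesis using D by auto
qed

text \<open>Positivity of \<open>w\<close> is assumed only up to \<open>t\<close>, so that this can
  serve in the proof of \<open>w_pos\<close>.\<close>

lemma V_antimono:
  assumes "0 < s" "s \<le> t" "\<And>x. 0 < x \<Longrightarrow> x \<le> t \<Longrightarrow> w x > 0"
  shows "V t \<le> V s"
proof (rule DERIV_nonpos_imp_nonincreasing[OF assms(2)])
  fix x assume x: "s \<le> x" "x \<le> t"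
  obtain D where "(V has_real_derivative D) (at x)" "D \<le> - (x powr (k - 1) * (x * z x - c * w x)\<^sup>2)"
    using V_deriv[of x] assms x \<psi>_pos[of x] by force
  moreover have "x powr (k - 1) * (x * z x - c * w x)\<^sup>2 \<ge> 0" by simp
  ultimately show "\<exists>y. (V has_real_derivative y) (at x) \<and> y \<le> 0" by (metis neg_le_0_iff_le order_trans)
qed

lemma V_at_right_0: "(V \<longlongrightarrow> 0) (at_right 0)"
proof -
  have p1: "((\<lambda>r::real. r powr k) \<longlongrightarrow> 0) (at_right 0)"
       and p2: "((\<lambda>r::real. r powr (k - 1)) \<longlongrightarrow> 0) (at_right 0)"
    using k by real_asymp+
  have "((\<lambda>r. r powr k * ((p - 1) / p * (z r * \<psi> r) + w r powr (q + 1) / (q + 1)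
      + e * (w r)\<^sup>2 / 2) - r powr (k - 1) * (l * w r * \<psi> r)) \<longlongrightarrow>
      0 * ((p - 1) / p * (0 * 0) + a powr (q + 1) / (q + 1) + e * a\<^sup>2 / 2) - 0 * (l * a * 0)) (at_right 0)"
    by (intro tendsto_intros p1 p2 at_right_limits) (use a q p in auto)
  moreover have "eventually (\<lambda>r. r powr k * ((p - 1) / p * (z r * \<psi> r) + w r powr (q + 1) / (q + 1)
      + e * (w r)\<^sup>2 / 2) - r powr (k - 1) * (l * w r * \<psi> r) = V r) (at_right 0)"
    using eventually_at_right_less[of 0]
    by eventually_elim (simp add: V_def powr_diff field_simps)
  ultimately show ?thesis by (simp add: filterlim_cong)
qed

text \<open>Strictness comes from c w - r z tending to c a > 0: the square in \<open>V_deriv\<close>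
  is positive near 0, so \<open>V\<close> falls strictly from its limit 0.\<close>

lemma V_neg_near_0: "\<exists>\<rho>>0. \<forall>r. 0 < r \<and> r < \<rho> \<longrightarrow> V r < 0"
proof -
  have "((\<lambda>r. c * w r - r * z r) \<longlongrightarrow> c * a - 0 * 0) (at_right 0)"
    by (intro tendsto_intros at_right_limits)
  hence "eventually (\<lambda>r. c * w r - r * z r > 0) (at_right 0)"
    by (rule order_tendstoD(1)) (use c a in simp)
  moreover have "eventually (\<lambda>r. w r > 0) (at_right 0)"
    by (rule order_tendstoD(1)[OF at_right_limits(1) a])
  ultimately have "eventually (\<lambda>r. c * w r - r * z r > 0 \<and> w r > 0) (at_right 0)"
    by eventually_elim auto
  then obtain \<rho> where \<rho>: "\<rho> > 0"
    and pos: "\<And>r. 0 < r \<Longrightarrow> r < \<rho> \<Longrightarrow> c * w r - r * z r > 0 \<and> w r > 0"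
    by (auto simp: eventually_at_right_field)
  have "V r < 0" if r: "0 < r" "r < \<rho>" for r
  proof -
    have "V r < V (r / 2)"
    proof (rule DERIV_neg_imp_decreasing[of "r / 2" r V])
      fix x assume x: "r / 2 \<le> x" "x \<le> r"
      obtain D where "(V has_real_derivative D) (at x)" "D \<le> - (x powr (k - 1) * (x * z x - c * w x)\<^sup>2)"
        using V_deriv[of x] pos x r \<psi>_pos[of x] by force
      moreover have "x powr (k - 1) * (x * z x - c * w x)\<^sup>2 > 0"
        using pos[of x] x r by (intro mult_pos_pos) auto
      ultimately show "\<exists>y. (V has_real_derivative y) (at x) \<and> y < 0" by (metis neg_less_0_iff_less le_less_trans)
    qed (use r in auto)
    moreover have "V (r / 2) \<le> 0"
    proof (rule tendsto_lowerbound[OF V_at_right_0])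
      have "eventually (\<lambda>s. s \<in> {0<..<r / 2}) (at_right 0)"
        using r by (intro eventually_at_right_real) auto
      thus "eventually (\<lambda>s. V (r / 2) \<le> V s) (at_right 0)"
        by eventually_elim (use r pos in \<open>auto intro!: V_antimono\<close>)
    qed simp
    ultimately show ?thesis by simp
  qed
  thus ?thesis using \<rho> by blast
qed

text \<open>The two nonnegative terms are dropped and \<open>e\<close> is replaced by its absolute
  value. Every remaining term carries a factor \<open>w\<close>, so the bound vanishes at a zero of
  \<open>w\<close>.\<close>

lemma neg_V_le:
  assumes "r > 0" "\<psi> r > 0"
  shows "- V r \<le> r powr k * (\<bar>e\<bar> * (w r)\<^sup>2 / 2 + l * w r * \<psi> r / r)"
proof -
  have "(p - 1) / p * (z r * \<psi> r) \<ge> 0" "w r powr (q + 1) / (q + 1) \<ge> 0"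
    using p q assms z_pos_iff[of r] by simp_all
  moreover have "- (e * (w r)\<^sup>2 / 2) \<le> \<bar>e\<bar> * (w r)\<^sup>2 / 2"
    by (smt (verit) minus_divide_left divide_right_mono mult_minus_left mult_right_mono zero_le_power2)
  ultimately have "- ((p - 1) / p * (z r * \<psi> r) + w r powr (q + 1) / (q + 1)
    + e * (w r)\<^sup>2 / 2 - l * w r * \<psi> r / r) \<le> \<bar>e\<bar> * (w r)\<^sup>2 / 2 + l * w r * \<psi> r / r"
    by linarith
  from mult_left_mono[OF this powr_ge_zero[of r k]] show ?thesis
    by (simp only: V_def mult_minus_right)
qed

theorem w_pos:
  assumes "r \<ge> 0"
  shows "w r > 0"
proof (rule ccontr)
  assume neg: "\<not> w r > 0"
  define S where "S = {0..r} \<inter> w -` {..0}"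
  have "closed S" unfolding S_def
    by (intro continuous_closed_preimage continuous_on_subset[OF w_cont]) auto
  moreover have "r \<in> S" using neg assms by (auto simp: S_def)
  moreover have bdd: "bdd_below S" by (rule bdd_belowI[of _ 0]) (auto simp: S_def)
  ultimately have tS: "Inf S \<in> S" using closed_contains_Inf[of S] by blast
  define t where "t = Inf S"
  have t: "t \<ge> 0" "t \<le> r" "w t \<le> 0" using tS by (auto simp: S_def t_def)
  have t0: "t > 0" using t w_0 a by (cases "t = 0") auto
  have before: "w s > 0" if "0 < s" "s < t" for s
    using that t cInf_lower[OF _ bdd, of s] by (force simp: S_def t_def)
  have lim: "(w \<longlongrightarrow> w t) (at_left t)" "(\<psi> \<longlongrightarrow> \<psi> t) (at_left t)"
    using DERIV_isCont[OF w_deriv[OF t0]] DERIV_isCont[OF \<psi>_deriv[OF t0]]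
    by (auto simp: isCont_def filterlim_at_split)
  have ev: "eventually (\<lambda>s. s \<in> {u<..<t}) (at_left t)" if "u < t" for u
    using that by (rule eventually_at_left_real)
  have "w t \<ge> 0"
    by (rule tendsto_lowerbound[OF lim(1)], rule eventually_mono[OF ev[OF t0]])
      (use before in \<open>auto simp: less_imp_le\<close>)
  hence wt: "w t = 0" using t by simp
  obtain \<rho> where \<rho>: "\<rho> > 0" "\<And>s. 0 < s \<Longrightarrow> s < \<rho> \<Longrightarrow> V s < 0" using V_neg_near_0 by blast
  define u where "u = min \<rho> t / 2"
  have u: "0 < u" "u < t" "V u < 0" using \<rho> t0 by (auto simp: u_def)
  \<comment> \<open>The bound for -V tends to 0 at the first zero \<open>t\<close>, while -V is at
    least -V(u) > 0 on (u, t). The limit is taken from the left because the sign of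
    \<open>\<psi>\<close> is known only before \<open>t\<close>.\<close>
  have "((\<lambda>s. s powr k * (\<bar>e\<bar> * (w s)\<^sup>2 / 2 + l * w s * \<psi> s / s)) \<longlongrightarrow>
      t powr k * (\<bar>e\<bar> * (w t)\<^sup>2 / 2 + l * w t * \<psi> t / t)) (at_left t)"
    by (intro tendsto_intros lim) (use t0 in auto)
  moreover have "eventually (\<lambda>s. - V u \<le> s powr k * (\<bar>e\<bar> * (w s)\<^sup>2 / 2 + l * w s * \<psi> s / s)) (at_left t)"
    using ev[OF u(2)]
  proof eventually_elim
    case (elim s)
    have "\<psi> s > 0" using elim u before by (intro \<psi>_pos) auto
    hence "- V s \<le> s powr k * (\<bar>e\<bar> * (w s)\<^sup>2 / 2 + l * w s * \<psi> s / s)"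
      using elim u by (intro neg_V_le) auto
    moreover have "V s \<le> V u" using elim u before by (intro V_antimono) auto
    ultimately show ?case by simp
  qed
  ultimately have "- V u \<le> t powr k * (\<bar>e\<bar> * (w t)\<^sup>2 / 2 + l * w t * \<psi> t / t)"
    by (intro tendsto_lowerbound) auto
  thus False using u wt by simp
qed

section \<open>A priori bounds and decay of the solution\<close>

lemma pos:
  assumes "r > 0"
  shows "w r > 0" "\<psi> r > 0" "z r > 0"
proof -
  show "w r > 0" using w_pos assms by simp
  show "\<psi> r > 0" using w_pos assms by (intro \<psi>_pos) auto
  thus "z r > 0" by (simp add: z_pos_iff)
qed

lemma \<psi>_deriv_pos:
  assumes "r > 0"
  shows "(\<psi> has_real_derivative
    \<alpha> * w r + w r powr q - r * z r - (real N - 1) / r * \<psi> r) (at r)"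
proof -
  have "signed_pow q (w r) = w r powr q"
    using pos[OF assms] by (simp add: signed_pow_def powr_diff)
  thus ?thesis using \<psi>_deriv[OF assms] by simp
qed

lemma w_antimono:
  assumes "0 < s" "s \<le> t"
  shows "w t \<le> w s"
proof (rule DERIV_nonpos_imp_nonincreasing[OF assms(2)])
  fix x assume "s \<le> x"
  hence "x > 0" using assms by simp
  thus "\<exists>y. (w has_real_derivative y) (at x) \<and> y \<le> 0"
    using w_deriv[of x] pos(3)[of x] by (intro exI[of _ "- z x"]) simp
qed

lemma V_1_neg: "V 1 < 0"
proof -
  obtain \<rho> where \<rho>: "\<rho> > 0" "\<And>r. 0 < r \<Longrightarrow> r < \<rho> \<Longrightarrow> V r < 0" using V_neg_near_0 by blast
  define s where "s = min \<rho> 1 / 2"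
  have s: "0 < s" "s < \<rho>" "s \<le> 1" using \<rho>(1) by (auto simp: s_def)
  have "V 1 \<le> V s" using s pos by (intro V_antimono) auto
  thus ?thesis using \<rho>(2)[OF s(1,2)] by simp
qed

lemma V_le_V_1: "r \<ge> 1 \<Longrightarrow> V r \<le> V 1"
  using pos by (intro V_antimono) auto

text \<open>A barrier against fast decay: since -V(1) > 0, \<open>w\<close> and
  \<open>\<psi>\<close>/r cannot become so small that the right-hand side tends to 0. The lower
  bounds for \<open>X\<close> rest on this.\<close>

lemma energy_bound:
  assumes "r \<ge> 1"
  shows "- V 1 \<le> r powr k * (\<bar>e\<bar> * (w r)\<^sup>2 / 2 + l * w r * \<psi> r / r)"
  using neg_V_le[of r] V_le_V_1[of r] pos[of r] assms by simp

text \<open>From \<open>V r < 0\<close> the positive factor r^k can be divided out.\<close>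

lemma z\<psi>_bound:
  assumes "r \<ge> 1"
  shows "(p - 1) / p * (z r * \<psi> r) \<le> \<bar>e\<bar> * (w r)\<^sup>2 / 2 + l * w r * \<psi> r / r"
proof -
  have "V r < 0" using V_le_V_1[OF assms] V_1_neg by simp
  hence "(p - 1) / p * (z r * \<psi> r) + w r powr (q + 1) / (q + 1)
    + e * (w r)\<^sup>2 / 2 - l * w r * \<psi> r / r < 0"
    unfolding V_def using assms by (subst (asm) mult_less_0_iff) auto
  moreover have "w r powr (q + 1) / (q + 1) \<ge> 0" using q by simp
  moreover have "- (e * (w r)\<^sup>2) \<le> \<bar>e\<bar> * (w r)\<^sup>2"
    using mult_right_mono[of "- e" "\<bar>e\<bar>" "(w r)\<^sup>2"] by simp
  ultimately show ?thesis by linarith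
qed

text \<open>Where \<open>\<psi> r > 1\<close>, dividing \<open>z\<psi>_bound\<close> by
  \<open>\<psi> r\<close> bounds \<open>z r\<close>, because w is at most \<open>w 1\<close>; then
  \<open>\<psi>\<close> = z^(p-1) is bounded too.\<close>

lemma \<psi>_bounded: "\<exists>\<Psi>. \<forall>r\<ge>1. \<psi> r \<le> \<Psi>"
proof -
  define C where "C = p / (p - 1) * (\<bar>e\<bar> * (w 1)\<^sup>2 / 2 + l * w 1)"
  have "\<psi> r \<le> max 1 (C powr (p - 1))" if r: "r \<ge> 1" for r
  proof (cases "\<psi> r \<le> 1")
    case False
    have w: "0 < w r" "w r \<le> w 1" and ps: "z r > 0" using r pos[of r] w_antimono[of 1 r] by auto
    have "\<bar>e\<bar> * (w r)\<^sup>2 / 2 \<le> \<bar>e\<bar> * (w 1)\<^sup>2 / 2 * 1"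
      using w by (simp add: divide_right_mono mult_left_mono power_mono)
    also have "\<dots> \<le> \<bar>e\<bar> * (w 1)\<^sup>2 / 2 * \<psi> r" using False by (intro mult_left_mono) auto
    finally have 1: "\<bar>e\<bar> * (w r)\<^sup>2 / 2 \<le> \<bar>e\<bar> * (w 1)\<^sup>2 / 2 * \<psi> r" .
    have "w r / r \<le> w 1 / 1" using w r by (intro frac_le) auto
    hence 2: "l * \<psi> r * (w r / r) \<le> l * \<psi> r * w 1" using l False by (intro mult_left_mono) auto
    have "(p - 1) / p * z r * \<psi> r \<le> (\<bar>e\<bar> * (w 1)\<^sup>2 / 2 + l * w 1) * \<psi> r"
      using z\<psi>_bound[OF r] 1 2 by (simp add: algebra_simps)
    hence "(p - 1) / p * z r \<le> \<bar>e\<bar> * (w 1)\<^sup>2 / 2 + l * w 1"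
      using False by (subst (asm) mult_le_cancel_right) auto
    hence "z r \<le> C" using p by (simp add: C_def field_simps)
    hence "\<psi> r \<le> C powr (p - 1)"
      using \<psi>_powr[OF ps] ps p by (simp add: powr_mono2)
    thus ?thesis by simp
  qed simp
  thus ?thesis by blast
qed

text \<open>Subtracting \<open>\<psi>\<close>/r cancels \<open>z\<close>, so the derivative involves
  \<open>w\<close> and \<open>\<psi>\<close> alone.\<close>

lemma flux_sum_deriv:
  assumes "r > 0"
  shows "((\<lambda>r. w r - \<psi> r / r) has_real_derivative
    - (\<alpha> * w r + w r powr q) / r + real N * \<psi> r / r\<^sup>2) (at r)"
  by (rule derivative_eq_intros w_deriv \<psi>_deriv_pos assms refl
      | use assms in \<open>simp add: field_simps power2_eq_square\<close>)+

text \<open>If \<open>w\<close> stayed above some \<epsilon> > 0, integrating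
  \<open>flux_sum_deriv\<close> would drive w - \<open>\<psi>\<close>/r to minus infinity like
  -\<alpha> \<epsilon> ln r, although it is bounded below because \<open>\<psi>\<close> is bounded.
  One small value suffices, as \<open>w\<close> decreases.\<close>

lemma w_tendsto_0: "(w \<longlongrightarrow> 0) at_top"
proof (rule decreasing_tendsto)
  show "eventually (\<lambda>r. 0 \<le> w r) at_top"
    using eventually_gt_at_top[of 0] by eventually_elim (simp add: pos less_imp_le)
next
  fix \<epsilon> :: real assume \<epsilon>: "0 < \<epsilon>"
  have "\<exists>r\<ge>1. w r < \<epsilon>"
  proof (rule ccontr)
    assume "\<not> ?thesis"
    hence ge: "\<And>r. r \<ge> 1 \<Longrightarrow> w r \<ge> \<epsilon>" by (force simp: not_less)
    obtain \<Psi> where \<Psi>: "\<And>r. r \<ge> 1 \<Longrightarrow> \<psi> r \<le> \<Psi>" using \<psi>_bounded by blast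
    have \<Psi>0: "\<Psi> > 0" using \<Psi>[of 1] pos[of 1] by simp
    \<comment> \<open>The added terms offset the extreme case w = \<epsilon>, \<open>\<psi>\<close>
      = \<Psi> of the derivative, which makes \<open>G\<close> nonincreasing.\<close>
    define G where "G r = (w r - \<psi> r / r) + \<alpha> * \<epsilon> * ln r + real N * \<Psi> / r" for r
    have le: "G r \<le> G 1" if "r \<ge> 1" for r
    proof (rule DERIV_nonpos_imp_nonincreasing[OF that])
      fix x :: real assume x: "1 \<le> x" "x \<le> r"
      define D where "D = - (\<alpha> * w x + w x powr q) / x + real N * \<psi> x / x\<^sup>2
          + \<alpha> * \<epsilon> / x - real N * \<Psi> / x\<^sup>2"
      have "(G has_real_derivative D) (at x)"
        unfolding G_def[abs_def] D_def
        by (rule derivative_eq_intros flux_sum_deriv refl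
            | use x in \<open>simp add: field_simps power2_eq_square\<close>)+
      moreover have "D = - ((\<alpha> * (w x - \<epsilon>) + w x powr q) / x) - real N * (\<Psi> - \<psi> x) / x\<^sup>2"
        using x unfolding D_def by (simp add: field_simps power2_eq_square)
      moreover have "(\<alpha> * (w x - \<epsilon>) + w x powr q) / x \<ge> 0" "real N * (\<Psi> - \<psi> x) / x\<^sup>2 \<ge> 0"
        using x ge[of x] \<Psi>[of x] \<alpha> by simp_all
      ultimately have "(G has_real_derivative D) (at x) \<and> D \<le> 0" by linarith
      thus "\<exists>y. (G has_real_derivative y) (at x) \<and> y \<le> 0" by blast
    qed
    have bound: "\<alpha> * \<epsilon> * ln r \<le> G 1 + \<Psi>" if r: "r \<ge> 1" for r
    proof -
      have "\<psi> r / r \<le> \<Psi> / 1" using \<Psi>[OF r] r \<Psi>0 by (intro frac_le) auto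
      moreover have "real N * \<Psi> / r \<ge> 0" "w r > 0" using r \<Psi>0 pos[of r] by simp_all
      ultimately show ?thesis using le[OF r] by (simp add: G_def)
    qed
    define c where "c = (G 1 + \<Psi>) / (\<alpha> * \<epsilon>)"
    have "eventually (\<lambda>r::real. c < ln r \<and> 1 \<le> r) at_top"
      by (intro eventually_conj eventually_ge_at_top) real_asymp
    then obtain r where r: "c < ln r" "1 \<le> r" by (auto dest: eventually_happens)
    have "\<alpha> * \<epsilon> * c < \<alpha> * \<epsilon> * ln r" using r \<alpha> \<epsilon> by (intro mult_strict_left_mono) auto
    moreover have "\<alpha> * \<epsilon> * c = G 1 + \<Psi>" using \<alpha> \<epsilon> by (simp add: c_def)
    ultimately show False using bound[OF r(2)] by linarith
  qed
  then obtain r where r: "r \<ge> 1" "w r < \<epsilon>" by blast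
  show "eventually (\<lambda>r. w r < \<epsilon>) at_top"
    using eventually_ge_at_top[of r]
  proof eventually_elim
    case (elim s)
    thus ?case using w_antimono[of r s] r by simp
  qed
qed

lemma eventually_source_small:
  assumes "\<epsilon> > 0"
  shows "eventually (\<lambda>r. w r powr (q - 1) < \<epsilon>) at_top"
proof -
  have "((\<lambda>r. w r powr (q - 1)) \<longlongrightarrow> 0 powr (q - 1)) at_top"
  proof (intro tendsto_powr' w_tendsto_0 tendsto_const)
    have "eventually (\<lambda>r. 0 \<le> w r) at_top"
      using eventually_gt_at_top[of 0] by eventually_elim (simp add: pos less_imp_le)
    thus "0 \<noteq> (0::real) \<or> 0 < q - 1 \<and> (\<forall>\<^sub>F r in at_top. 0 \<le> w r)" using q by simp
  qed
  thus ?thesis using assms by (simp add: order_tendstoD(2))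
qed

section \<open>Logarithmic variables, growth of \<open>X\<close> and its consequence\<close>

definition "X r = r * w r / \<psi> r"
text \<open>The logarithmic decay rate -d(ln w)/d(ln r); it equals \<alpha> for a multiple of
  r^(-\<alpha>).\<close>

definition "h r = r * z r / w r"
definition "lnY r = p * ln r + (2 - p) * ln (w r)"

lemma X_h_pos: "r > 0 \<Longrightarrow> X r > 0" "r > 0 \<Longrightarrow> h r > 0"
  using pos by (simp_all add: X_def h_def)

text \<open>The form is centred at h = \<alpha> and X = 1, so that signs can be read off: the
  product is positive if h - \<alpha> exceeds w^(q-1) and X > 1.\<close>

lemma ln_X_deriv:
  assumes "r > 0"
  shows "((\<lambda>r. ln (X r)) has_real_derivative
    ((real N - \<alpha> - w r powr (q - 1)) + (h r - \<alpha> - w r powr (q - 1)) * (X r - 1)) / r) (at r)"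
proof -
  note ps = pos[OF assms]
  have wq: "w r powr q = w r powr (q - 1) * w r" using ps by (simp add: powr_diff)
  have "((\<lambda>r. r * w r / \<psi> r) has_real_derivative
      ((1 * w r + - z r * r) * \<psi> r - r * w r * (\<alpha> * w r + w r powr q - r * z r - (real N - 1) / r * \<psi> r))
        / (\<psi> r * \<psi> r)) (at r)"
    using ps by (intro DERIV_divide DERIV_mult DERIV_ident w_deriv \<psi>_deriv_pos assms) auto
  hence "((\<lambda>r. ln (r * w r / \<psi> r)) has_real_derivative
      1 / (r * w r / \<psi> r) * (((1 * w r + - z r * r) * \<psi> r - r * w r * (\<alpha> * w r + w r powr q - r * z r - (real N - 1) / r * \<psi> r))
        / (\<psi> r * \<psi> r))) (at r)"
    by (rule DERIV_chain2[OF DERIV_ln_divide, rotated]) (use ps assms in simp)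
  moreover have "1 / (r * w r / \<psi> r) * (((1 * w r + - z r * r) * \<psi> r - r * w r * (\<alpha> * w r + w r powr q - r * z r - (real N - 1) / r * \<psi> r))
        / (\<psi> r * \<psi> r)) = ((real N - \<alpha> - w r powr (q - 1)) + (h r - \<alpha> - w r powr (q - 1)) * (X r - 1)) / r"
    using ps assms unfolding wq X_def h_def by (simp add: divide_simps) (simp add: algebra_simps)
  ultimately show ?thesis by (simp add: X_def)
qed

lemma lnY_deriv:
  assumes "r > 0"
  shows "(lnY has_real_derivative (p - (2 - p) * h r) / r) (at r)"
proof -
  have "((\<lambda>r. ln (w r)) has_real_derivative 1 / w r * (- z r)) (at r)"
    by (rule DERIV_chain2[OF DERIV_ln_divide w_deriv[OF assms]]) (use pos[OF assms] in simp)
  hence "(lnY has_real_derivative p * (1 / r) + (2 - p) * (1 / w r * (- z r))) (at r)"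
    unfolding lnY_def[abs_def] by (intro DERIV_add DERIV_cmult DERIV_ln_divide assms)
  moreover have "p * (1 / r) + (2 - p) * (1 / w r * (- z r)) = (p - (2 - p) * h r) / r"
    using pos[OF assms] assms by (simp add: h_def field_simps)
  ultimately show ?thesis by simp
qed

lemma lnY_eq:
  assumes "r > 0"
  shows "lnY r = ln (X r) + (p - 1) * ln (h r)"
proof -
  note ps = pos[OF assms]
  have "ln (\<psi> r) = (p - 1) * ln (z r)" using \<psi>_powr[OF ps(3)] ps by (simp add: ln_powr)
  thus ?thesis using ps assms
    by (simp add: lnY_def X_def h_def ln_mult ln_div algebra_simps)
qed

text \<open>The minimum of \<open>f\<close> and \<open>g\<close> never falls below its value at
  \<open>R\<close>, however often \<open>h\<close> crosses \<alpha> + \<eta>; the resulting lower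
  bound on \<open>f\<close> is the growth of \<open>X\<close>.\<close>

lemma X_growth:
  assumes R: "R > 0" and \<eta>: "\<eta> > 0"
    and rate_Y: "\<And>x. 0 < x \<Longrightarrow> x \<le> \<alpha> + \<eta> \<Longrightarrow> \<kappa> < p - (2 - p) * x"
    and rate_X: "\<And>r. r \<ge> R \<Longrightarrow> h r \<ge> \<alpha> + \<eta> \<Longrightarrow>
      \<kappa> < (real N - \<alpha> - w r powr (q - 1)) + (h r - \<alpha> - w r powr (q - 1)) * (X r - 1)"
  shows "\<exists>C>0. \<forall>r\<ge>R. C * r powr \<kappa> \<le> X r"
proof -
  \<comment> \<open>\<open>f\<close> increases where \<open>h \<ge> \<alpha> + \<eta>\<close>, that is, where \<open>f \<le> g\<close>, and \<open>g\<close> increases where \<open>g \<le> f\<close>.\<close>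
  define f where "f r = ln (X r) - \<kappa> * ln r" for r
  define g where "g r = lnY r - (p - 1) * ln (\<alpha> + \<eta>) - \<kappa> * ln r" for r
  have cmp: "(f r \<le> g r \<longleftrightarrow> \<alpha> + \<eta> \<le> h r) \<and> (g r \<le> f r \<longleftrightarrow> h r \<le> \<alpha> + \<eta>)" if "r > 0" for r
    using p X_h_pos[OF that] \<alpha> \<eta> by (simp add: f_def g_def lnY_eq[OF that])
  have df: "(f has_real_derivative ((real N - \<alpha> - w r powr (q - 1))
      + (h r - \<alpha> - w r powr (q - 1)) * (X r - 1)) / r - \<kappa> / r) (at r)" if "r \<ge> R" for r
    unfolding f_def[abs_def] using that R
    by (intro DERIV_diff ln_X_deriv) (auto intro!: derivative_eq_intros)
  have dg: "(g has_real_derivative (p - (2 - p) * h r) / r - 0 - \<kappa> / r) (at r)" if "r \<ge> R" for r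
    unfolding g_def[abs_def] using that R
    by (intro DERIV_diff DERIV_const lnY_deriv) (auto intro!: derivative_eq_intros)
  define m where "m = min (f R) (g R)"
  have "exp m * r powr \<kappa> \<le> X r" if r: "r \<ge> R" for r
  proof -
    have "m \<le> min (f r) (g r)" unfolding m_def
    proof (rule min_mono_of_deriv_pos[OF df dg _ _ r])
      fix x assume x: "R \<le> x" "f x \<le> g x"
      thus "0 < ((real N - \<alpha> - w x powr (q - 1))
        + (h x - \<alpha> - w x powr (q - 1)) * (X x - 1)) / x - \<kappa> / x"
        using rate_X[of x] cmp[of x] R by (simp add: diff_divide_distrib[symmetric])
    next
      fix x assume x: "R \<le> x" "g x \<le> f x"
      thus "0 < (p - (2 - p) * h x) / x - 0 - \<kappa> / x"
        using rate_Y[of "h x"] cmp[of x] R X_h_pos[of x] by (simp add: diff_divide_distrib[symmetric])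
    qed
    hence "m + \<kappa> * ln r \<le> ln (X r)" by (simp add: f_def)
    hence "exp (m + \<kappa> * ln r) \<le> X r" using X_h_pos[of r] r R by (simp add: ln_ge_iff)
    thus ?thesis using r R by (simp add: exp_add powr_def)
  qed
  thus ?thesis by (intro exI[of _ "exp m"]) auto
qed

text \<open>The derivative of J = ln (r^\<alpha> (w - \<open>\<psi>\<close>/r)) is controlled in two
  rounds. Its upper bound is integrable at once and yields w = O(r^(-\<alpha>)); this makes the
  source term w^(q-1)/r in the lower bound integrable as well. So \<open>J\<close> has a finite
  limit.\<close>

lemma limit_pos_if_X_growth:
  assumes C: "C > 0" and \<kappa>: "\<kappa> > 0" and ge: "\<And>r. r \<ge> R0 \<Longrightarrow> C * r powr \<kappa> \<le> X r"
  shows "\<exists>L>0. ((\<lambda>r. r powr \<alpha> * w r) \<longlongrightarrow> L) at_top"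
proof -
  have "eventually (\<lambda>r. 2 \<le> C * r powr \<kappa>) at_top"
    using C \<kappa> by real_asymp
  then obtain R1 where R1: "\<And>r. r \<ge> R1 \<Longrightarrow> 2 \<le> C * r powr \<kappa>"
    by (auto simp: eventually_at_top_linorder)
  define R where "R = max 1 (max R0 R1)"
  have R: "r \<ge> 1" "C * r powr \<kappa> \<le> X r" "2 \<le> X r" if "r \<ge> R" for r
    using that ge[of r] R1[of r] by (auto simp: R_def)
  have inv_X: "1 / X r \<le> r powr - \<kappa> / C" if "r \<ge> R" for r
  proof -
    have "1 / X r \<le> 1 / (C * r powr \<kappa>)" using R[OF that] C by (intro divide_left_mono) auto
    thus ?thesis by (simp add: powr_minus field_simps)
  qed
  \<comment> \<open>From \<open>R\<close> on X is at least 2, so b = w/X is at most w/2 and ln (w -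
    b) is defined.\<close>
  define b where "b r = \<psi> r / r" for r
  have b: "b r = w r * (1 / X r)" "0 < b r" "b r \<le> w r / 2" "0 < w r" "0 < r" if "r \<ge> R" for r
  proof -
    show r: "0 < r" using R[OF that] by simp
    note ps = pos[OF r]
    show 1: "b r = w r * (1 / X r)" using ps r by (simp add: b_def X_def)
    show "0 < b r" "0 < w r" using ps r by (auto simp: b_def)
    have "1 / X r \<le> 1 / 2" using R[OF that] by (intro divide_left_mono) auto
    thus "b r \<le> w r / 2" unfolding 1 using mult_left_mono[of "1 / X r" "1 / 2" "w r"] ps by simp
  qed
  define J where "J r = \<alpha> * ln r + ln (w r - b r)" for r
  \<comment> \<open>In J' the \<alpha> w from differentiating \<alpha> ln r cancels the one in
    \<open>flux_sum_deriv\<close>.\<close>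
  define D where "D r = ((real N - \<alpha>) * b r - w r powr q) / (w r - b r) / r" for r
  have J_deriv: "(J has_real_derivative D r) (at r)" if "r \<ge> R" for r
  proof -
    note bs = b[OF that]
    have "((\<lambda>r. w r - b r) has_real_derivative
        - (\<alpha> * w r + w r powr q) / r + real N * \<psi> r / r\<^sup>2) (at r)"
      unfolding b_def[abs_def] by (rule flux_sum_deriv) (use bs in simp)
    hence "((\<lambda>r. ln (w r - b r)) has_real_derivative 1 / (w r - b r) *
        (- (\<alpha> * w r + w r powr q) / r + real N * \<psi> r / r\<^sup>2)) (at r)"
      by (rule DERIV_chain2[OF DERIV_ln_divide, rotated]) (use bs in linarith)
    hence "(J has_real_derivative \<alpha> * (1 / r) + 1 / (w r - b r) *
        (- (\<alpha> * w r + w r powr q) / r + real N * \<psi> r / r\<^sup>2)) (at r)"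
      unfolding J_def[abs_def] by (intro DERIV_add DERIV_cmult DERIV_ln_divide) (use bs in auto)
    moreover have "\<psi> r = r * b r" using bs(5) by (simp add: b_def)
    hence "\<alpha> * (1 / r) + 1 / (w r - b r) *
        (- (\<alpha> * w r + w r powr q) / r + real N * \<psi> r / r\<^sup>2) = D r"
      using bs(2-5) unfolding D_def by (simp add: divide_simps power2_eq_square) (simp add: algebra_simps)
    ultimately show ?thesis by simp
  qed
  have D_le: "D r \<le> 2 * real N / C * r powr (- \<kappa> - 1)" if "r \<ge> R" for r
  proof -
    note bs = b[OF that]
    have "0 \<le> \<alpha> * b r + w r powr q" using bs(2) \<alpha> by simp
    hence "D r \<le> (real N * b r) / (w r / 2) / r"
      unfolding D_def using bs(2-5)
      by (intro divide_right_mono frac_le) (auto simp: left_diff_distrib)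
    also have "\<dots> = 2 * real N * (1 / X r) / r" using bs by simp
    also have "\<dots> \<le> 2 * real N * (r powr - \<kappa> / C) / r"
      using bs inv_X[OF that] by (intro divide_right_mono mult_left_mono) auto
    also have "\<dots> = 2 * real N / C * r powr (- \<kappa> - 1)" using bs by (simp add: powr_diff)
    finally show ?thesis .
  qed
  have D_ge: "D r \<ge> - (2 * \<alpha> / C * r powr (- \<kappa> - 1)) - 2 * w r powr (q - 1) / r" if "r \<ge> R" for r
  proof -
    note bs = b[OF that]
    have "0 \<le> real N * b r" using bs(2) by simp
    hence "- D r \<le> (\<alpha> * b r + w r powr q) / (w r - b r) / r"
      unfolding D_def minus_divide_left using bs(2-5)
      by (intro divide_right_mono) (auto simp: left_diff_distrib)
    also have "\<dots> \<le> (\<alpha> * b r + w r powr q) / (w r / 2) / r"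
      using bs(2-5) \<alpha> by (intro divide_right_mono divide_left_mono mult_pos_pos add_nonneg_nonneg) auto
    also have "\<dots> = 2 * \<alpha> * (1 / X r) / r + 2 * w r powr (q - 1) / r"
      using bs by (simp add: powr_diff field_simps)
    also have "2 * \<alpha> * (1 / X r) / r \<le> 2 * \<alpha> * (r powr - \<kappa> / C) / r"
      using bs inv_X[OF that] \<alpha> by (intro divide_right_mono mult_left_mono) auto
    also have "\<dots> = 2 * \<alpha> / C * r powr (- \<kappa> - 1)" using bs by (simp add: powr_diff)
    finally show ?thesis by linarith
  qed
  \<comment> \<open>The correction has derivative -(2 N/C) r^(-\<kappa>-1), which offsets
    \<open>D_le\<close> exactly.\<close>
  define G where "G r = J r + 2 * real N / (C * \<kappa>) * r powr - \<kappa>" for r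
  have G_anti: "G y \<le> G x" if "R \<le> x" "x \<le> y" for x y
  proof (rule DERIV_nonpos_imp_nonincreasing[OF that(2)])
    fix t assume t: "x \<le> t" "t \<le> y"
    have tR: "t \<ge> R" using t that by simp
    have "(G has_real_derivative D t + 2 * real N / (C * \<kappa>) * (- \<kappa> * t powr (- \<kappa> - 1))) (at t)"
      unfolding G_def[abs_def]
      by (intro DERIV_add DERIV_cmult J_deriv tR has_real_derivative_powr b(5)[OF tR])
    moreover have "2 * real N / (C * \<kappa>) * (- \<kappa> * t powr (- \<kappa> - 1)) = - (2 * real N / C * t powr (- \<kappa> - 1))"
      using \<kappa> by simp
    ultimately show "\<exists>y. (G has_real_derivative y) (at t) \<and> y \<le> 0"
      using D_le[OF tR] by fastforce
  qed
  have J_eq: "exp (J r) = r powr \<alpha> * (w r - b r)" if "r \<ge> R" for r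
    using b(2-5)[OF that] by (simp add: J_def exp_add powr_def)
  \<comment> \<open>The factor 2 comes from w - b being at least w/2.\<close>
  define K where "K = 2 * exp (G R)"
  have w_le: "w r \<le> K * r powr - \<alpha>" if "r \<ge> R" for r
  proof -
    note bs = b[OF that]
    have "J r \<le> G r" using C \<kappa> by (simp add: G_def)
    also have "\<dots> \<le> G R" using G_anti that by simp
    finally have "r powr \<alpha> * (w r - b r) \<le> exp (G R)" by (simp flip: J_eq[OF that])
    moreover have "r powr \<alpha> * (w r / 2) \<le> r powr \<alpha> * (w r - b r)"
      using bs(2-5) by (intro mult_left_mono) auto
    ultimately have "r powr \<alpha> * w r \<le> K" by (simp add: K_def)
    thus ?thesis using bs(5) by (simp add: powr_minus field_simps)
  qed
  define \<beta> where "\<beta> = \<alpha> * (q - 1)"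
  have \<beta>: "\<beta> > 0" using \<alpha> q by (simp add: \<beta>_def)
  define M where "M = 2 * K powr (q - 1)"
  have source: "2 * w r powr (q - 1) / r \<le> M * r powr (- \<beta> - 1)" if "r \<ge> R" for r
  proof -
    note bs = b[OF that]
    have "w r powr (q - 1) \<le> (K * r powr - \<alpha>) powr (q - 1)"
      using w_le[OF that] bs(4) q by (intro powr_mono2) auto
    also have "\<dots> = K powr (q - 1) * r powr - \<beta>"
      by (simp add: powr_mult powr_powr \<beta>_def K_def)
    finally have "2 * w r powr (q - 1) / r \<le> 2 * (K powr (q - 1) * r powr - \<beta>) / r"
      using bs(5) by (intro divide_right_mono mult_left_mono) auto
    also have "\<dots> = M * r powr (- \<beta> - 1)"
      using bs(5) by (simp add: M_def powr_diff)
    finally show ?thesis .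
  qed
  \<comment> \<open>The counterpart of \<open>G\<close>: the subtracted terms offset
    \<open>D_ge\<close> and \<open>source\<close>, so \<open>H\<close> is nondecreasing and its
    initial value bounds \<open>G\<close> from below.\<close>
  define H where "H r = J r - 2 * \<alpha> / (C * \<kappa>) * r powr - \<kappa> - M / \<beta> * r powr - \<beta>" for r
  have H_mono: "H R \<le> H y" if "R \<le> y" for y
  proof (rule DERIV_nonneg_imp_nondecreasing[OF that])
    fix t assume t: "R \<le> t" "t \<le> y"
    have "(H has_real_derivative D t - 2 * \<alpha> / (C * \<kappa>) * (- \<kappa> * t powr (- \<kappa> - 1))
        - M / \<beta> * (- \<beta> * t powr (- \<beta> - 1))) (at t)"
      unfolding H_def[abs_def]
      by (intro DERIV_diff DERIV_cmult J_deriv t has_real_derivative_powr b(5))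
    moreover have "2 * \<alpha> / (C * \<kappa>) * (- \<kappa> * t powr (- \<kappa> - 1)) = - (2 * \<alpha> / C * t powr (- \<kappa> - 1))"
      "M / \<beta> * (- \<beta> * t powr (- \<beta> - 1)) = - (M * t powr (- \<beta> - 1))"
      using \<kappa> \<beta> by simp_all
    ultimately show "\<exists>y. (H has_real_derivative y) (at t) \<and> 0 \<le> y"
      using D_ge[OF t(1)] source[OF t(1)] by fastforce
  qed
  have G_ge: "H R \<le> G r" if "R \<le> r" for r
  proof -
    have "0 \<le> 2 * \<alpha> / (C * \<kappa>) * r powr - \<kappa>" "0 \<le> M / \<beta> * r powr - \<beta>"
      using C \<kappa> \<beta> \<alpha> by (simp_all add: M_def)
    hence "H r \<le> J r" unfolding H_def by linarith
    moreover have "J r \<le> G r" using C \<kappa> by (simp add: G_def)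
    ultimately show ?thesis using H_mono[OF that] by simp
  qed
  obtain L where L: "(G \<longlongrightarrow> L) at_top"
    using antimono_bounded_below_tendsto[of R G "H R"] G_anti G_ge by blast
  have "((\<lambda>r::real. 2 * real N / (C * \<kappa>) * r powr - \<kappa>) \<longlongrightarrow> 2 * real N / (C * \<kappa>) * 0) at_top"
    using \<kappa> by (intro tendsto_intros tendsto_neg_powr filterlim_ident) auto
  from tendsto_diff[OF L this] have J_lim: "(J \<longlongrightarrow> L) at_top" by (simp add: G_def)
  have "((\<lambda>r. 1 / X r) \<longlongrightarrow> 0) at_top"
  proof (rule tendsto_sandwich[of "\<lambda>_. 0" _ _ "\<lambda>r. r powr - \<kappa> / C"])
    show "eventually (\<lambda>r. 0 \<le> 1 / X r) at_top" "eventually (\<lambda>r. 1 / X r \<le> r powr - \<kappa> / C) at_top"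
      using eventually_ge_at_top[of R] by (eventually_elim, use R inv_X in force)+
    have "((\<lambda>r. r powr - \<kappa> / C) \<longlongrightarrow> 0 / C) at_top"
      using \<kappa> C by (intro tendsto_intros tendsto_neg_powr filterlim_ident) auto
    thus "((\<lambda>r. r powr - \<kappa> / C) \<longlongrightarrow> 0) at_top" by simp
  qed simp
  \<comment> \<open>Passing from w - b back to \<open>w\<close> costs the factor 1 - 1/X, which
    tends to 1.\<close>
  hence "((\<lambda>r. exp (J r) / (1 - 1 / X r)) \<longlongrightarrow> exp L / (1 - 0)) at_top"
    by (intro tendsto_intros J_lim) auto
  moreover have "eventually (\<lambda>r. exp (J r) / (1 - 1 / X r) = r powr \<alpha> * w r) at_top"
    using eventually_ge_at_top[of R]
  proof eventually_elim
    case (elim r)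
    have "1 - 1 / X r \<noteq> 0" using R[OF elim] by simp
    moreover have "exp (J r) = r powr \<alpha> * w r * (1 - 1 / X r)"
      unfolding J_eq[OF elim] b(1)[OF elim] by (simp add: algebra_simps)
    ultimately show ?case by simp
  qed
  ultimately have "((\<lambda>r. r powr \<alpha> * w r) \<longlongrightarrow> exp L) at_top"
    by (simp add: filterlim_cong)
  thus ?thesis by (intro exI[of _ "exp L"]) auto
qed

section \<open>Lower bounds for \<open>X\<close> from the Pohozaev-type function\<close>

text \<open>J = r^N (w - \<open>\<psi>\<close>/r) is positive exactly when X > 1, and it eventually
  increases because w^(q-1) tends to 0. If it never became positive it would stay bounded, forcing w
  and \<open>\<psi>\<close>/r to be O(r^(-N)), against \<open>energy_bound\<close>.\<close>

lemma X_gt_1_of_k_eq_N: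
  assumes k_eq: "k = real N" and \<alpha>N: "\<alpha> < real N"
  shows "eventually (\<lambda>r. X r > 1) at_top"
proof -
  define n where "n = real N"
  have n: "n \<ge> 1" "\<alpha> < n" using N \<alpha>N by (auto simp: n_def)
  define \<kappa> where "\<kappa> = (n - \<alpha>) / 2"
  have \<kappa>: "\<kappa> > 0" using n by (simp add: \<kappa>_def)
  obtain R1 where R1: "\<And>r. r \<ge> R1 \<Longrightarrow> w r powr (q - 1) < \<kappa>"
    using eventually_source_small[OF \<kappa>] by (auto simp: eventually_at_top_linorder)
  define R where "R = max 1 R1"
  have R: "r \<ge> 1" "r > 0" "w r powr (q - 1) < \<kappa>" if "r \<ge> R" for r
    using that R1[of r] by (auto simp: R_def)
  define J where "J r = r powr n * (w r - \<psi> r / r)" for r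
  define D where "D r = r powr (n - 1) * (w r * (n - \<alpha> - w r powr (q - 1)))" for r
  have J_deriv: "(J has_real_derivative D r) (at r)" if "r > 0" for r
  proof -
    have "(J has_real_derivative n * r powr (n - 1) * (w r - \<psi> r / r)
        + (- (\<alpha> * w r + w r powr q) / r + real N * \<psi> r / r\<^sup>2) * r powr n) (at r)"
      unfolding J_def[abs_def]
      by (intro DERIV_mult has_real_derivative_powr flux_sum_deriv that)
    moreover have "r powr n = r powr (n - 1) * r" "w r powr q = w r powr (q - 1) * w r"
      using that pos[OF that] by (simp_all add: powr_diff)
    hence "n * r powr (n - 1) * (w r - \<psi> r / r)
        + (- (\<alpha> * w r + w r powr q) / r + real N * \<psi> r / r\<^sup>2) * r powr n = D r"
      using that by (simp add: D_def n_def field_simps power2_eq_square)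
    ultimately show ?thesis by simp
  qed
  have D_ge: "D r \<ge> \<kappa> * r powr (n - 1) * w r" if "r \<ge> R" for r
  proof -
    have "w r * \<kappa> \<le> w r * (n - \<alpha> - w r powr (q - 1))"
      using R[OF that] pos[of r] by (intro mult_left_mono) (auto simp: \<kappa>_def field_simps)
    from mult_left_mono[OF this, of "r powr (n - 1)"] show ?thesis by (simp add: D_def mult_ac)
  qed
  have J_mono: "J s \<le> J t" if "R \<le> s" "s \<le> t" for s t
  proof (rule DERIV_nonneg_imp_nondecreasing[OF that(2)])
    fix x assume x: "s \<le> x" "x \<le> t"
    have xR: "x \<ge> R" using x that by simp
    have "0 \<le> \<kappa> * x powr (n - 1) * w x" using \<kappa> pos[of x] R[OF xR] by simp
    thus "\<exists>y. (J has_real_derivative y) (at x) \<and> 0 \<le> y"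
      using J_deriv[of x] D_ge[OF xR] R[OF xR] by fastforce
  qed
  have "\<exists>r\<ge>R. J r > 0"
  proof (rule ccontr)
    assume "\<not> ?thesis"
    hence J_neg: "\<And>r. r \<ge> R \<Longrightarrow> J r \<le> 0" by (auto simp: not_less)
    define B where "B = - J R"
    define B1 where "B1 = n / \<kappa> * B + w R * R powr n"
    have w_bound: "r powr n * w r \<le> B1" if r: "r \<ge> R" for r
    proof -
      \<comment> \<open>Here \<open>w r\<close> is frozen: as \<open>w\<close> decreases, J' is at
        least \<kappa> x^(n-1) w(r) on [R, r], and J <= 0 turns the integrated inequality into a
        bound for r^n w(r).\<close>
      define F where "F s = J s - \<kappa> * w r / n * s powr n" for s
      have "F R \<le> F r"
      proof (rule DERIV_nonneg_imp_nondecreasing[OF r])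
        fix x assume x: "R \<le> x" "x \<le> r"
        have "(F has_real_derivative D x - \<kappa> * w r / n * (n * x powr (n - 1))) (at x)"
          unfolding F_def[abs_def] using R[OF x(1)]
          by (intro DERIV_diff DERIV_cmult J_deriv has_real_derivative_powr) auto
        moreover have "\<kappa> * x powr (n - 1) * w r \<le> \<kappa> * x powr (n - 1) * w x"
          using w_antimono[of x r] R[OF x(1)] x \<kappa> by (intro mult_left_mono) auto
        hence "D x - \<kappa> * w r / n * (n * x powr (n - 1)) \<ge> 0"
          using D_ge[OF x(1)] n by (simp add: mult_ac)
        ultimately show "\<exists>y. (F has_real_derivative y) (at x) \<and> 0 \<le> y" by blast
      qed
      hence "\<kappa> * w r / n * r powr n \<le> B + \<kappa> * w r / n * R powr n"
        using J_neg[OF r] by (simp add: F_def B_def)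
      moreover have "\<kappa> * w r / n * R powr n \<le> \<kappa> * w R / n * R powr n"
        using w_antimono[of R r] R[of R] r \<kappa> n
        by (intro mult_right_mono divide_right_mono mult_left_mono) auto
      moreover have "\<kappa> / n * B1 = B + \<kappa> * w R / n * R powr n"
        using \<kappa> n by (simp add: B1_def field_simps)
      moreover have "\<kappa> / n * (r powr n * w r) = \<kappa> * w r / n * r powr n" by simp
      ultimately have "\<kappa> / n * (r powr n * w r) \<le> \<kappa> / n * B1" by linarith
      thus ?thesis using \<kappa> n by (subst (asm) mult_le_cancel_left_pos) auto
    qed
    define B2 where "B2 = B1 + B"
    have \<psi>_bound: "r powr n * (\<psi> r / r) \<le> B2" if r: "r \<ge> R" for r
      using J_mono[of R r] w_bound[OF r] r by (simp add: J_def B2_def B_def algebra_simps)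
    define M where "M = \<bar>e\<bar> * B1\<^sup>2 / 2 + l * (B1 * B2)"
    have bound: "- V 1 * r powr n \<le> M" if r: "r \<ge> R" for r
    proof -
      note rs = R[OF r]
      note ps = pos[OF rs(2)]
      have "0 \<le> r powr n * w r" using ps by simp
      hence B1: "0 \<le> B1" using w_bound[OF r] by linarith
      \<comment> \<open>The extra r^n splits each quadratic term into two of the bounded factors r^n
        w and r^n \<open>\<psi>\<close>/r, whereas the left-hand side is unbounded.\<close>
      have "- V 1 * r powr n \<le> r powr n * (\<bar>e\<bar> * (w r)\<^sup>2 / 2 + l * w r * \<psi> r / r) * r powr n"
        using energy_bound[OF rs(1)] by (intro mult_right_mono) (auto simp: k_eq n_def)
      also have "\<dots> = \<bar>e\<bar> * (r powr n * w r)\<^sup>2 / 2 + l * ((r powr n * w r) * (r powr n * (\<psi> r / r)))"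
        by (simp add: power2_eq_square algebra_simps)
      also have "\<dots> \<le> M"
        unfolding M_def using w_bound[OF r] \<psi>_bound[OF r] ps rs l B1
        by (intro add_mono divide_right_mono mult_left_mono power_mono mult_mono) auto
      finally show ?thesis .
    qed
    have "n > 0" using n by simp
    define c where "c = M / (- V 1)"
    have "eventually (\<lambda>r. r powr n > c) at_top" using \<open>n > 0\<close> by real_asymp
    hence "eventually (\<lambda>r. - V 1 * r powr n > M) at_top"
      by eventually_elim (use V_1_neg in \<open>simp add: c_def field_simps\<close>)
    hence "eventually (\<lambda>r::real. False) at_top"
      using eventually_ge_at_top[of R] by eventually_elim (use bound in force)
    thus False by simp
  qed
  then obtain r0 where r0: "r0 \<ge> R" "J r0 > 0" by blast
  show ?thesis using eventually_ge_at_top[of r0]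
  proof eventually_elim
    case (elim r)
    hence "J r > 0" using J_mono[of r0 r] r0 by simp
    hence "w r - \<psi> r / r > 0" by (simp add: J_def zero_less_mult_iff)
    thus ?case using R[of r] pos[of r] elim r0 by (simp add: X_def field_simps)
  qed
qed

text \<open>At a radius where X < X0, both \<open>h\<close> and \<open>lnY\<close> are bounded by
  constants. For p > 2 this fails at large radii, because w^(2-p) is bounded below and Y grows like
  r^p at least. For p < 2 it makes w and \<open>\<psi>\<close>/r of order r^(-\<delta>) with
  \<delta> > \<alpha>, against \<open>energy_bound\<close>.\<close>

lemma X_large_of_k_eq_2\<alpha>:
  assumes k_eq: "k = 2 * \<alpha>" and cond: "p > 2 \<or> (p < 2 \<and> \<alpha> < p / (2 - p))"
  shows "eventually (\<lambda>r. X r \<ge> X0) at_top"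
proof (cases "X0 > 0")
  case False
  show ?thesis using eventually_gt_at_top[of 0]
    by eventually_elim (use X_h_pos(1) False in force)
next
  case X0: True
  \<comment> \<open>Since w^2 = X (w \<open>\<psi>\<close>/r), dividing \<open>z\<psi>_bound\<close>
    by w \<open>\<psi>\<close>/r gives this bound for \<open>h\<close>.\<close>
  define H where "H = p / (p - 1) * (\<bar>e\<bar> * X0 / 2 + l)"
  define \<Lambda> where "\<Lambda> = ln X0 + (p - 1) * ln H"
  have small: "h r \<le> H" "lnY r \<le> \<Lambda>" if r: "r \<ge> 1" and X: "X r < X0" for r
  proof -
    have r0: "r > 0" using r by simp
    note ps = pos[OF r0]
    have "(p - 1) / p * h r * (w r * \<psi> r / r) = (p - 1) / p * (z r * \<psi> r)"
      using ps r0 by (simp add: h_def)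
    also have "\<dots> \<le> \<bar>e\<bar> * (w r)\<^sup>2 / 2 + l * w r * \<psi> r / r" by (rule z\<psi>_bound[OF r])
    also have "\<dots> = (\<bar>e\<bar> * X r / 2 + l) * (w r * \<psi> r / r)"
      using ps r0 by (simp add: X_def field_simps power2_eq_square)
    finally have "(p - 1) / p * h r \<le> \<bar>e\<bar> * X r / 2 + l"
      using ps r0 by (subst (asm) mult_le_cancel_right) auto
    also have "\<dots> \<le> \<bar>e\<bar> * X0 / 2 + l" using X by (simp add: divide_right_mono mult_left_mono)
    finally show hH: "h r \<le> H" using p by (simp add: H_def field_simps)
    have "ln (X r) \<le> ln X0" using X X_h_pos[OF r0] by simp
    moreover have "(p - 1) * ln (h r) \<le> (p - 1) * ln H"
      using hH X_h_pos[OF r0] p by (intro mult_left_mono) auto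
    ultimately show "lnY r \<le> \<Lambda>" by (simp add: \<Lambda>_def lnY_eq[OF r0])
  qed
  show ?thesis
  proof (cases "p > 2")
    case True
    define c where "c = (\<Lambda> + (p - 2) * ln (w 1)) / p"
    have "eventually (\<lambda>r::real. c < ln r) at_top" by real_asymp
    hence "eventually (\<lambda>r. p * ln r > \<Lambda> + (p - 2) * ln (w 1)) at_top"
      by eventually_elim (use p in \<open>simp add: c_def field_simps\<close>)
    thus ?thesis using eventually_ge_at_top[of 1]
    proof eventually_elim
      case (elim r)
      show ?case
      proof (rule ccontr)
        assume "\<not> X0 \<le> X r"
        hence "lnY r \<le> \<Lambda>" using small elim by simp
        moreover have "(p - 2) * ln (w r) \<le> (p - 2) * ln (w 1)"
          using True elim w_antimono[of 1 r] pos[of r] pos[of 1] by (intro mult_left_mono) auto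
        ultimately show False using elim by (simp add: lnY_def algebra_simps)
      qed
    qed
  next
    case False
    hence p2: "p < 2" "\<alpha> < p / (2 - p)" using cond by auto
    \<comment> \<open>The decay exponent for which r^p w^(2-p) is constant.\<close>
    define \<delta> where "\<delta> = p / (2 - p)"
    have \<delta>: "\<delta> > \<alpha>" "\<delta> * (2 - p) = p" using p2 by (auto simp: \<delta>_def)
    define C1 where "C1 = exp (\<Lambda> / (2 - p))"
    define C2 where "C2 = exp ((p - 1) * (ln H + \<Lambda> / (2 - p)))"
    define M where "M = \<bar>e\<bar> * C1\<^sup>2 / 2 + l * (C1 * C2)"
    have "((\<lambda>r. M * r powr (2 * \<alpha> - 2 * \<delta>)) \<longlongrightarrow> M * 0) at_top"
      using \<delta>(1) by (intro tendsto_intros tendsto_neg_powr filterlim_ident) auto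
    hence "eventually (\<lambda>r. M * r powr (2 * \<alpha> - 2 * \<delta>) < - V 1) at_top"
      by (rule order_tendstoD(2)) (use V_1_neg in simp)
    thus ?thesis using eventually_ge_at_top[of 1]
    proof eventually_elim
      case (elim r)
      have r: "r > 0" "r \<ge> 1" using elim by simp_all
      note ps = pos[OF r(1)]
      show ?case
      proof (rule ccontr)
        assume "\<not> X0 \<le> X r"
        hence s: "h r \<le> H" "lnY r \<le> \<Lambda>" using small elim by simp_all
        have exp_eq: "exp (x - \<delta> * ln r) = exp x * r powr - \<delta>" for x
          using r by (simp add: powr_def flip: exp_add)
        have "(2 - p) * (\<Lambda> / (2 - p) - \<delta> * ln r) = \<Lambda> - \<delta> * (2 - p) * ln r"
          using p2 by (simp add: field_simps)
        hence "(2 - p) * ln (w r) \<le> (2 - p) * (\<Lambda> / (2 - p) - \<delta> * ln r)"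
          using s(2) unfolding \<delta>(2) lnY_def by linarith
        hence lw: "ln (w r) \<le> \<Lambda> / (2 - p) - \<delta> * ln r" using p2 by simp
        hence "exp (ln (w r)) \<le> exp (\<Lambda> / (2 - p) - \<delta> * ln r)" by (simp only: exp_le_cancel_iff)
        hence w: "w r \<le> C1 * r powr - \<delta>" using ps(1) by (simp add: C1_def exp_eq)
        have "ln (h r) \<le> ln H" using s X_h_pos[OF r(1)] by simp
        hence "ln (z r) \<le> ln H + ln (w r) - ln r" using ps r by (simp add: h_def ln_mult ln_div)
        hence "ln (z r) \<le> ln H + (\<Lambda> / (2 - p) - \<delta> * ln r) - ln r" using lw by linarith
        hence "(p - 1) * ln (z r) \<le> (p - 1) * (ln H + (\<Lambda> / (2 - p) - \<delta> * ln r) - ln r)"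
          using p by (intro mult_left_mono) auto
        moreover have "ln (\<psi> r) = (p - 1) * ln (z r)"
          using \<psi>_powr[OF ps(3)] ps by (simp add: ln_powr)
        ultimately have "ln (\<psi> r / r) \<le> (p - 1) * (ln H + (\<Lambda> / (2 - p) - \<delta> * ln r) - ln r) - ln r"
          using ps r by (simp add: ln_div)
        also have "\<dots> = (p - 1) * (ln H + \<Lambda> / (2 - p)) - ((p - 1) * \<delta> + p) * ln r"
          by (simp add: algebra_simps)
        \<comment> \<open>Hence \<open>\<psi>\<close>/r obeys a bound with the same exponent as
          \<open>w\<close>.\<close>
        also have "(p - 1) * \<delta> + p = \<delta>" using \<delta>(2) by (simp add: algebra_simps)
        finally have "exp (ln (\<psi> r / r)) \<le> exp ((p - 1) * (ln H + \<Lambda> / (2 - p)) - \<delta> * ln r)"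
          by (simp only: exp_le_cancel_iff)
        moreover have "exp (ln (\<psi> r / r)) = \<psi> r / r" using ps(2) r(1) by simp
        ultimately have \<psi>: "\<psi> r / r \<le> C2 * r powr - \<delta>" by (simp only: C2_def exp_eq)
        have "- V 1 \<le> r powr (2 * \<alpha>) * (\<bar>e\<bar> * (w r)\<^sup>2 / 2 + l * (w r * (\<psi> r / r)))"
          using energy_bound[OF r(2)] by (simp add: k_eq mult.assoc)
        also have "\<dots> \<le> r powr (2 * \<alpha>) * (\<bar>e\<bar> * (C1 * r powr - \<delta>)\<^sup>2 / 2
            + l * ((C1 * r powr - \<delta>) * (C2 * r powr - \<delta>)))"
          using w \<psi> ps r l
          by (intro mult_left_mono add_mono divide_right_mono power_mono mult_mono)
            (auto simp: C1_def)
        also have "\<dots> = M * (r powr (2 * \<alpha>) * (r powr - \<delta> * r powr - \<delta>))"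
          by (simp add: M_def power2_eq_square algebra_simps)
        also have "r powr (2 * \<alpha>) * (r powr - \<delta> * r powr - \<delta>) = r powr (2 * \<alpha> - 2 * \<delta>)"
          by (simp add: powr_add[symmetric])
        finally show False using elim by simp
      qed
    qed
  qed
qed

section \<open>Positivity of the limit\<close>

lemma rate_margin:
  assumes "p > 2 \<or> (p < 2 \<and> \<alpha> < p / (2 - p))"
  shows "\<exists>\<eta>>0. \<exists>\<kappa>>0. \<forall>x. 0 < x \<and> x \<le> \<alpha> + \<eta> \<longrightarrow> \<kappa> \<le> p - (2 - p) * x"
proof (cases "p > 2")
  case True
  have "p \<le> p - (2 - p) * x" if "x > 0" for x
    using True that mult_nonpos_nonneg[of "2 - p" x] by simp
  thus ?thesis using p by (intro exI[of _ 1] conjI exI[of _ p]) auto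
next
  case False
  hence p2: "p < 2" "\<alpha> < p / (2 - p)" using assms by auto
  \<comment> \<open>Half of the gap between \<alpha> and p/(2-p): the other half keeps the rate at
    least (2-p) \<eta>.\<close>
  define \<eta> where "\<eta> = (p / (2 - p) - \<alpha>) / 2"
  have \<eta>: "\<eta> > 0" using p2 by (simp add: \<eta>_def)
  have "(2 - p) * \<eta> \<le> p - (2 - p) * x" if "x \<le> \<alpha> + \<eta>" for x
  proof -
    have "(2 - p) * (x + \<eta>) \<le> (2 - p) * (p / (2 - p))"
    proof (rule mult_left_mono)
      have "2 * \<eta> = p / (2 - p) - \<alpha>" unfolding \<eta>_def by simp
      thus "x + \<eta> \<le> p / (2 - p)" using that by linarith
    qed (use p2 in simp)
    moreover have "(2 - p) * (p / (2 - p)) = p" using p2 by simp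
    ultimately show ?thesis by (simp only: distrib_left)
  qed
  thus ?thesis using \<eta> p2 by (intro exI[of _ \<eta>] conjI exI[of _ "(2 - p) * \<eta>"]) auto
qed

theorem limit_pos:
  assumes cond: "p > 2 \<or> (p < 2 \<and> \<alpha> < p / (2 - p))"
    and k: "(k = real N \<and> \<alpha> < real N) \<or> k = 2 * \<alpha>"
  shows "\<exists>L>0. ((\<lambda>r. r powr \<alpha> * w r) \<longlongrightarrow> L) at_top"
proof -
  obtain \<eta> \<kappa> where \<eta>: "\<eta> > 0" and \<kappa>: "\<kappa> > 0"
    and rate: "\<And>x. 0 < x \<Longrightarrow> x \<le> \<alpha> + \<eta> \<Longrightarrow> \<kappa> \<le> p - (2 - p) * x"
    using rate_margin[OF cond] by blast
  \<comment> \<open>The lower bound on r d(ln X)/dr where h >= \<alpha> + \<eta>; this is where the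
    two choices of \<open>k\<close> differ.\<close>
  have "\<exists>\<mu>>0. eventually (\<lambda>r. h r \<ge> \<alpha> + \<eta> \<longrightarrow>
      \<mu> \<le> (real N - \<alpha> - w r powr (q - 1)) + (h r - \<alpha> - w r powr (q - 1)) * (X r - 1)) at_top"
    using k
  proof
    assume k: "k = real N \<and> \<alpha> < real N"
    define \<mu> where "\<mu> = (real N - \<alpha>) / 2"
    have \<mu>: "\<mu> > 0" using k by (simp add: \<mu>_def)
    have "eventually (\<lambda>r. X r > 1) at_top" using X_gt_1_of_k_eq_N k by blast
    moreover have "eventually (\<lambda>r. w r powr (q - 1) < min \<eta> \<mu>) at_top"
      using \<eta> \<mu> by (intro eventually_source_small) auto
    ultimately have "eventually (\<lambda>r. h r \<ge> \<alpha> + \<eta> \<longrightarrow>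
      \<mu> \<le> (real N - \<alpha> - w r powr (q - 1)) + (h r - \<alpha> - w r powr (q - 1)) * (X r - 1)) at_top"
    proof eventually_elim
      case (elim r)
      show ?case
      proof
        assume "\<alpha> + \<eta> \<le> h r"
        hence "(h r - \<alpha> - w r powr (q - 1)) * (X r - 1) \<ge> 0"
          using elim by (intro mult_nonneg_nonneg) auto
        moreover have "\<mu> \<le> real N - \<alpha> - w r powr (q - 1)"
          using elim by (simp add: \<mu>_def field_simps)
        ultimately show "\<mu> \<le> (real N - \<alpha> - w r powr (q - 1))
            + (h r - \<alpha> - w r powr (q - 1)) * (X r - 1)" by simp
      qed
    qed
    thus ?thesis using \<mu> by blast
  next
    assume k: "k = 2 * \<alpha>"
    \<comment> \<open>The threshold makes (\<eta>/2)(X - 1) at least \<alpha> + 2, enough to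
      compensate N - \<alpha> - w^(q-1), which may be negative but exceeds -\<alpha> - 1.\<close>
    have "eventually (\<lambda>r. X r \<ge> 1 + 2 * (\<alpha> + 2) / \<eta>) at_top"
      by (rule X_large_of_k_eq_2\<alpha>[OF k cond])
    moreover have "eventually (\<lambda>r. w r powr (q - 1) < min (\<eta> / 2) 1) at_top"
      using \<eta> by (intro eventually_source_small) auto
    ultimately have "eventually (\<lambda>r. h r \<ge> \<alpha> + \<eta> \<longrightarrow>
      1 \<le> (real N - \<alpha> - w r powr (q - 1)) + (h r - \<alpha> - w r powr (q - 1)) * (X r - 1)) at_top"
    proof eventually_elim
      case (elim r)
      show ?case
      proof
        assume "\<alpha> + \<eta> \<le> h r"
        hence "(\<eta> / 2) * (2 * (\<alpha> + 2) / \<eta>) \<le> (h r - \<alpha> - w r powr (q - 1)) * (X r - 1)"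
          using elim \<eta> \<alpha> by (intro mult_mono) auto
        moreover have "(\<eta> / 2) * (2 * (\<alpha> + 2) / \<eta>) = \<alpha> + 2" using \<eta> by simp
        moreover have "w r powr (q - 1) < 1" using elim by simp
        ultimately show "1 \<le> (real N - \<alpha> - w r powr (q - 1))
            + (h r - \<alpha> - w r powr (q - 1)) * (X r - 1)" by linarith
      qed
    qed
    thus ?thesis by (intro exI[of _ 1]) auto
  qed
  then obtain \<mu> R1 where \<mu>: "\<mu> > 0" and R1: "\<And>r. r \<ge> R1 \<Longrightarrow> h r \<ge> \<alpha> + \<eta> \<Longrightarrow>
      \<mu> \<le> (real N - \<alpha> - w r powr (q - 1)) + (h r - \<alpha> - w r powr (q - 1)) * (X r - 1)"
    by (auto simp: eventually_at_top_linorder)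
  \<comment> \<open>Halving makes the exponent strictly smaller than both rates, as
    \<open>X_growth\<close> requires.\<close>
  define \<nu> where "\<nu> = min \<kappa> \<mu> / 2"
  have \<nu>: "0 < \<nu>" "\<nu> < \<kappa>" "\<nu> < \<mu>" using \<kappa> \<mu> by (auto simp: \<nu>_def)
  have "\<exists>C>0. \<forall>r\<ge>max 1 R1. C * r powr \<nu> \<le> X r"
  proof (rule X_growth[OF _ \<eta>])
    fix x assume "0 < x" "x \<le> \<alpha> + \<eta>"
    thus "\<nu> < p - (2 - p) * x" using rate \<nu> by force
  next
    fix r assume "max 1 R1 \<le> r" "\<alpha> + \<eta> \<le> h r"
    thus "\<nu> < (real N - \<alpha> - w r powr (q - 1)) + (h r - \<alpha> - w r powr (q - 1)) * (X r - 1)"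
      using R1[of r] \<nu> by simp
  qed simp
  then obtain C where "C > 0" "\<And>r. r \<ge> max 1 R1 \<Longrightarrow> C * r powr \<nu> \<le> X r" by blast
  thus ?thesis using limit_pos_if_X_growth \<nu> by blast
qed

end

section \<open>Choice of the parameters in the three cases\<close>

theorem theorem3p11:
  fixes N :: nat and p q \<alpha> a :: real and w :: "real \<Rightarrow> real"
  assumes "N \<ge> 1" and "p > 1" and "q > 1" and "\<alpha> > 0"
    and "p > 2 \<or> (p < 2 \<and> \<alpha> < p / (2 - p))"
    and "(p2 N < p \<and> \<alpha> \<le> real N / 2 \<and> q_star N p \<le> ereal q) \<or>
         (p \<le> p2 N \<and> 1 < q) \<or>
         (p2 N < p \<and> real N / 2 < \<alpha> \<and> \<alpha> < (real N - 1) * conj_exp p / 2 \<and>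
           q_star_alpha N p \<alpha> \<le> q)"
    and "is_solution N p q \<alpha> a w"
    and "a > 0"
  shows "(\<forall>r\<ge>0. w r > 0) \<and>
         (\<exists>L. ((\<lambda>r. r powr \<alpha> * w r) \<longlongrightarrow> L) at_top \<and> L > 0)"
proof -
  note A = assms(1-5)
  have "\<exists>dw df. radial_ivp N p q \<alpha> a w dw df"
    using assms(7) A assms(8) unfolding is_solution_def radial_ivp_def by blast
  then obtain dw df where ivp: "radial_ivp N p q \<alpha> a w dw df" by blast
  have conclude: ?thesis if poh: "pohozaev_ivp_axioms N p q \<alpha> k e l c"
      and k_choice: "(k = real N \<and> \<alpha> < real N) \<or> k = 2 * \<alpha>" for k e l c
  proof -
    interpret pohozaev_ivp N p q \<alpha> a w dw df k e l c
      by (intro pohozaev_ivp.intro ivp poh)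
    show ?thesis using w_pos limit_pos[OF A(5) k_choice] by blast
  qed
  \<comment> \<open>With k = N and c = N/2, \<open>coeff_mixed\<close> determines \<open>e\<close>,
    and \<open>coeff_square\<close> becomes the sign condition on (N/2 - \<alpha>)(N/2 - l).\<close>
  have k_eq_N: ?thesis
    if N1: "real N > 1" and \<alpha>: "\<alpha> < real N" and l0: "l > 0" and l1: "l \<le> (real N - p) / p"
      and l2: "real N / (q + 1) \<le> l" and l3: "(real N / 2 - \<alpha>) * (real N / 2 - l) \<ge> 0" for l
  proof (rule conclude[where k = "real N" and e = "\<alpha> + l - real N" and l = l and c = "real N / 2"])
    show "pohozaev_ivp_axioms N p q \<alpha> (real N) (\<alpha> + l - real N) l (real N / 2)"
    proof
      have "real N * (p - 1) / p - (real N - 1) + (real N - p) / p = 0"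
        using A by (simp add: field_simps)
      thus "real N * (p - 1) / p - (real N - 1) + l \<le> 0" using l1 by linarith
      have "- (real N / 2)\<^sup>2 - (real N * (\<alpha> + l - real N) / 2 - l * \<alpha>) = (real N / 2 - \<alpha>) * (real N / 2 - l)"
        by (simp add: field_simps power2_eq_square)
      thus "real N * (\<alpha> + l - real N) / 2 - l * \<alpha> \<le> - (real N / 2)\<^sup>2" using l3 by linarith
    qed (use N1 l0 l2 in auto)
  qed (use \<alpha> in simp)
  from assms(6) show ?thesis
  proof (elim disjE conjE)
    assume *: "p2 N < p" "\<alpha> \<le> real N / 2" "q_star N p \<le> ereal q"
    \<comment> \<open>For N <= p the exponent \<open>q_star\<close> is infinite, so the real
      \<open>q\<close> could not reach it.\<close>
    have pN: "p < real N" using *(3) by (auto simp: q_star_def split: if_splits)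
    have q: "(real N * (p - 1) + p) / (real N - p) \<le> q" using *(3) pN by (simp add: q_star_def)
    show ?thesis
    \<comment> \<open>The largest \<open>l\<close> compatible with \<open>coeff_z\<close>. Then q >=
      q* is equivalent to N/(q+1) <= l, and p > p2 makes l < N/2.\<close>
    proof (rule k_eq_N[of "(real N - p) / p"])
      have "real N * (p - 1) + p \<le> q * (real N - p)" using q pN by (simp add: divide_le_eq)
      hence "real N * p \<le> (real N - p) * (q + 1)" by (simp add: algebra_simps)
      thus "real N / (q + 1) \<le> (real N - p) / p" using A by (simp add: field_simps)
      have "2 * real N \<le> p * (real N + 2)" using *(1) by (simp add: p2_def divide_less_eq)
      hence "(real N - p) / p \<le> real N / 2" using A by (simp add: field_simps)
      thus "(real N / 2 - \<alpha>) * (real N / 2 - (real N - p) / p) \<ge> 0" using * by simp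
    qed (use A pN * in auto)
  next
    assume *: "p \<le> p2 N"
    have p: "p * (real N + 2) \<le> 2 * real N" using * by (simp add: p2_def le_divide_eq)
    have "p < 2"
    proof (rule ccontr)
      assume "\<not> p < 2"
      hence "2 * (real N + 2) \<le> p * (real N + 2)" by (intro mult_right_mono) auto
      thus False using p by simp
    qed
    \<comment> \<open>As p < 2, the upper bound on \<alpha> applies, and p <= p2 means p/(2-p) <=
      N/2.\<close>
    hence "\<alpha> < p / (2 - p)" using A by auto
    also have "\<dots> \<le> real N / 2" using p \<open>p < 2\<close> by (simp add: field_simps)
    finally have \<alpha>: "\<alpha> < real N / 2" .
    have N1: "real N > 1"
    proof -
      have "1 * (real N + 2) < p * (real N + 2)" using A by (intro mult_strict_right_mono) auto
      hence "1 * (real N + 2) < 2 * real N" using p by (rule less_le_trans)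
      thus ?thesis by simp
    qed
    show ?thesis
    \<comment> \<open>With l = N/2 the product in the sign condition is 0; p <= p2 and q > 1 give
      the upper and lower bounds on \<open>l\<close>.\<close>
    proof (rule k_eq_N[of "real N / 2"])
      show "real N / 2 \<le> (real N - p) / p" using p A by (simp add: field_simps)
      show "real N / (q + 1) \<le> real N / 2" using A by (intro divide_left_mono) auto
    qed (use N1 \<alpha> in auto)
  next
    assume *: "p2 N < p" "real N / 2 < \<alpha>" "\<alpha> < (real N - 1) * conj_exp p / 2"
      "q_star_alpha N p \<alpha> \<le> q"
    \<comment> \<open>This gives equality in \<open>coeff_z\<close> for k = 2 \<alpha>, and l/(2
      \<alpha>) is the reciprocal of q*_\<alpha> + 1, so q >= q*_\<alpha> becomes
      \<open>coeff_q\<close>.\<close>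
    define l where "l = real N - 1 - 2 * \<alpha> * (p - 1) / p"
    have l: "l > 0" using *(3) A by (simp add: l_def conj_exp_def field_simps)
    have "real N \<noteq> 1" using * A by auto
    hence N1: "real N > 1" using A by simp
    hence N2: "real N \<ge> 2" by simp
    have "(real N - 1) / (2 * \<alpha>) - 1 / conj_exp p = l / (2 * \<alpha>)"
      using A by (simp add: l_def conj_exp_def field_simps)
    hence "2 * \<alpha> / l \<le> q + 1" using *(4) by (simp add: q_star_alpha_def)
    hence "2 * \<alpha> / (q + 1) \<le> l" using l A by (simp add: field_simps)
    moreover have "2 * \<alpha> * (p - 1) / p - (real N - 1) + l \<le> 0" by (simp add: l_def)
    \<comment> \<open>With e = l - \<alpha> and c = \<alpha> this holds with equality.\<close>
    moreover have "2 * \<alpha> * (l - \<alpha>) / 2 - l * \<alpha> \<le> - \<alpha>\<^sup>2"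
      by (simp add: power2_eq_square field_simps)
    ultimately have "pohozaev_ivp_axioms N p q \<alpha> (2 * \<alpha>) (l - \<alpha>) l \<alpha>"
      using l A * N2 by unfold_locales auto
    thus ?thesis by (rule conclude) simp
  qed
qed

end
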